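(* For every $n\ge 1$ there is a constant $c_n>0$ depending only on $n$ such that the following hold for every $1\le p<\infty$, every weight $w$ in $\mathbb{R}^n$, every cube $Q$ in $\mathbb{R}^n$ and every $u\in L^1_{\mathrm{loc}}(\mathbb{R}^n)$, where $u_Q=\frac1{|Q|}\int_Q u\,dx$. (a) If $0<\delta<1$ and $0<\varepsilon\le\delta$, then $$\left(\int_Q|u(x)-u_Q|^p\,w(x)\,dx\right)^{1/p}\le c_n\,\frac{(1-\delta)^{\frac1p}}{\varepsilon}\,\ell(Q)^{\varepsilon}\left(\int_Q\int_Q\frac{|u(x)-u(y)|^p}{|x-y|^{n+\delta p}}\,dy\,M_{(\delta-\varepsilon)p,Q}(w\chi_Q)(x)\,dx\right)^{1/p}.$$ (b) Hence, if $\frac12<\delta<1$, $$\left(\int_Q|u(x)-u_Q|^p\,w(x)\,dx\right)^{1/p}\le c_n\,(1-\delta)^{\frac1p}\,\ell(Q)^{\delta}\left(\int_Q\int_Q\frac{|u(x)-u(y)|^p}{|x-y|^{n+\delta p}}\,dy\,M(w\chi_Q)(x)\,dx\right)^{1/p},$$ and in particular, for any pair of weights $(w,v)\in A_1$, $$\left(\int_Q|u(x)-u_Q|^p\,w(x)\,dx\right)^{1/p}\le c_n\,(1-\delta)^{\frac1p}\,\ell(Q)^{\delta}\,[w,v]_{A_1}^{\frac1p}\left(\int_Q\int_Q\frac{|u(x)-u(y)|^p}{|x-y|^{n+\delta p}}\,dy\,v(x)\,dx\right)^{1/p}.$$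
   Context: A cube in $\mathbb{R}^n$ is a cartesian product of $n$ intervals of the same side length $\ell(Q)$. A weight is a function $w\in L^1_{\mathrm{loc}}(\mathbb{R}^n)$ with $w(x)>0$ for a.e. $x$. For $\alpha\ge0$ and a cube $Q_0$, the local fractional maximal function is $M_{\alpha,Q_0}f(x)=\sup \ell(R)^\alpha\frac1{|R|}\int_R|f(y)|\,dy$, $x\in Q_0$, the supremum over all cubes $R\subset Q_0$ with $x\in R$. $M$ is the non-centered Hardy–Littlewood maximal function $Mf(x)=\sup_{R\ni x}\frac1{|R|}\int_R|f|\,dy$, the supremum over all cubes $R$ in $\mathbb{R}^n$ containing $x$. A pair of weights $(w,v)$ belongs to $A_1$ if $[w,v]_{A_1}:=\operatorname{ess\,sup}_{x\in\mathbb{R}^n}\frac{Mw(x)}{v(x)}<\infty$. *)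

theory Defs
  imports "HOL-Probability.Essential_Supremum"
begin

text \<open>
  The ambient space is \<open>real ^ 'n\<close> with Lebesgue measure. Integrals of nonnegative quantities
  are taken in \<open>ennreal\<close>, so that inequalities between possibly infinite quantities are
  meaningful (with the usual convention \<open>0 * \<infinity> = 0\<close>).
\<close>

text \<open>The interval factors of a cube are bounded and nondegenerate; each of them may be open,
  closed or half-open.\<close>

definition cube_of_side :: "(real ^ 'n) set \<Rightarrow> real \<Rightarrow> bool" where
  "cube_of_side Q l \<longleftrightarrow> l > 0 \<and>
     (\<exists>I a. (\<forall>i. {a i<..<a i + l} \<subseteq> I i \<and> I i \<subseteq> {a i..a i + l}) \<and> Q = {x. \<forall>i. x $ i \<in> I i})"

definition is_cube :: "(real ^ 'n) set \<Rightarrow> bool" where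
  "is_cube Q \<longleftrightarrow> (\<exists>l. cube_of_side Q l)"

definition side_length :: "(real ^ 'n) set \<Rightarrow> real" where
  "side_length Q = (THE l. cube_of_side Q l)"

lemma cube_of_side_le:
  fixes Q :: "(real ^ 'n) set"
  assumes "cube_of_side Q l" "cube_of_side Q l'"
  shows "l \<le> l'"
proof -
  obtain I a where I: "\<And>i. {a i<..<a i + l} \<subseteq> I i" "Q = {x. \<forall>i. x $ i \<in> I i}" and l: "l > 0"
    using assms(1) unfolding cube_of_side_def by metis
  obtain J b where J: "\<And>i. J i \<subseteq> {b i..b i + l'}" "Q = {x. \<forall>i. x $ i \<in> J i}"
    using assms(2) unfolding cube_of_side_def by metis
  fix k :: 'n
  have "{a k<..<a k + l} \<subseteq> {b k..b k + l'}"
  proof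
    fix t assume t: "t \<in> {a k<..<a k + l}"
    define x :: "real ^ 'n" where "x = (\<chi> i. if i = k then t else a i + l / 2)"
    have "x $ i \<in> {a i<..<a i + l}" for i
      using t l by (simp add: x_def)
    then have "x \<in> Q"
      using I by blast
    then have "x $ k \<in> J k"
      using J(2) by blast
    then show "t \<in> {b k..b k + l'}"
      using J(1)[of k] by (auto simp: x_def)
  qed
  then show ?thesis
    using l by (simp add: greaterThanLessThan_subseteq_atLeastAtMost_iff)
qed

lemma side_length_eq: "cube_of_side Q l \<Longrightarrow> side_length Q = l"
  unfolding side_length_def by (blast intro: the_equality antisym cube_of_side_le)

definition locally_integrable :: "(real ^ 'n \<Rightarrow> real) \<Rightarrow> bool" where
  "locally_integrable f \<longleftrightarrow> (\<forall>K. compact K \<longrightarrow> set_integrable lebesgue K f)"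

definition weight :: "(real ^ 'n \<Rightarrow> real) \<Rightarrow> bool" where
  "weight w \<longleftrightarrow> locally_integrable w \<and> (AE x in lebesgue. w x > 0)"

definition average :: "(real ^ 'n) set \<Rightarrow> (real ^ 'n \<Rightarrow> real) \<Rightarrow> real" where
  "average Q u = (LINT x:Q|lebesgue. u x) / measure lebesgue Q"

text \<open>The average of \<open>\<bar>f\<bar>\<close>, which may be infinite.\<close>

definition abs_average :: "(real ^ 'n) set \<Rightarrow> (real ^ 'n \<Rightarrow> real) \<Rightarrow> ennreal" where
  "abs_average R f = (\<integral>\<^sup>+y\<in>R. ennreal \<bar>f y\<bar> \<partial>lebesgue) / emeasure lebesgue R"

text \<open>Only used for \<open>x\<close> in \<open>Q\<^sub>0\<close>.\<close>

definition local_frac_maximal ::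
    "real \<Rightarrow> (real ^ 'n) set \<Rightarrow> (real ^ 'n \<Rightarrow> real) \<Rightarrow> real ^ 'n \<Rightarrow> ennreal" where
  "local_frac_maximal \<alpha> Q\<^sub>0 f x =
     (SUP R \<in> {R. is_cube R \<and> R \<subseteq> Q\<^sub>0 \<and> x \<in> R}. ennreal (side_length R powr \<alpha>) * abs_average R f)"

definition HL_maximal :: "(real ^ 'n \<Rightarrow> real) \<Rightarrow> real ^ 'n \<Rightarrow> ennreal" where
  "HL_maximal f x = (SUP R \<in> {R. is_cube R \<and> x \<in> R}. abs_average R f)"

text \<open>The library sets \<open>esssup\<close> of a non-measurable function to \<open>\<infinity>\<close>. This does not interfere
  here: a union of nondegenerate cubes is Lebesgue measurable, hence so is \<open>HL_maximal w\<close>.\<close>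

definition A1_const :: "(real ^ 'n \<Rightarrow> real) \<Rightarrow> (real ^ 'n \<Rightarrow> real) \<Rightarrow> ennreal" where
  "A1_const w v = esssup lebesgue (\<lambda>x. HL_maximal w x / ennreal (v x))"

definition A1_pair :: "(real ^ 'n \<Rightarrow> real) \<Rightarrow> (real ^ 'n \<Rightarrow> real) \<Rightarrow> bool" where
  "A1_pair w v \<longleftrightarrow> weight w \<and> weight v \<and> A1_const w v < \<infinity>"

text \<open>Real powers on \<open>[0, \<infinity>]\<close>, for positive exponents only.\<close>

definition epowr :: "ennreal \<Rightarrow> real \<Rightarrow> ennreal" where
  "epowr t r = (if t = \<infinity> then \<infinity> else ennreal (enn2real t powr r))"

definition weighted_osc ::
    "real \<Rightarrow> (real ^ 'n) set \<Rightarrow> (real ^ 'n \<Rightarrow> real) \<Rightarrow> (real ^ 'n \<Rightarrow> real) \<Rightarrow> ennreal" where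
  "weighted_osc p Q w u =
     epowr (\<integral>\<^sup>+x\<in>Q. ennreal (\<bar>u x - average Q u\<bar> powr p * w x) \<partial>lebesgue) (1 / p)"

definition frac_seminorm ::
    "real \<Rightarrow> real \<Rightarrow> (real ^ 'n) set \<Rightarrow> (real ^ 'n \<Rightarrow> ennreal) \<Rightarrow> (real ^ 'n \<Rightarrow> real) \<Rightarrow> ennreal" where
  "frac_seminorm \<delta> p Q W u =
     epowr (\<integral>\<^sup>+x\<in>Q.
        (\<integral>\<^sup>+y\<in>Q. ennreal (\<bar>u x - u y\<bar> powr p / norm (x - y) powr (real CARD('n) + \<delta> * p)) \<partial>lebesgue)
        * W x \<partial>lebesgue) (1 / p)"

end

theory Submission
  imports Defs "HOL-Probability.Probability_Measure"
begin

text \<open>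
  Write \<open>K(x,y) = \<bar>u x - u y\<bar>\<^sup>p / \<bar>x - y\<bar>\<^bsup>n + \<delta>p\<^esup>\<close> and \<open>g(x) = \<integral>\<^sub>Q K(x,y) dy\<close>. The proof telescopes along the
  dyadic subcubes of \<open>Q\<close>: if \<open>Q\<^sub>k(x)\<close> is the one of side \<open>l\<^sub>k = l / 2\<^sup>k\<close> that contains \<open>x\<close>, and
  \<open>A\<^sub>k(x)\<close> is the average of \<open>u\<close> over it, then \<open>u - u\<^sub>Q = \<Sum>\<^sub>k (A\<^bsub>k+1\<^esub> - A\<^sub>k)\<close> wherever \<open>g\<close> is finite,
  because \<open>\<bar>u - A\<^sub>k\<bar>\<^sup>p\<close> is at most a constant times \<open>l\<^sub>k\<^bsup>\<delta>p\<^esup> g\<close>.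

  The factor \<open>1 - \<delta>\<close> comes from an unweighted inequality on each subcube,
  \<open>\<integral>\<^sub>R\<integral>\<^sub>R \<bar>u x - u y\<bar>\<^sup>p \<le> C p (1 - \<delta>) \<rho>\<^bsup>n + \<delta>p\<^esup> \<integral>\<^sub>R\<integral>\<^sub>R K\<close>, valid in every convex set \<open>R\<close> of diameter at
  most \<open>\<rho>\<close> (\<open>fractional_poincare_convex\<close>). Passing through midpoints shows that the part of the left
  side with \<open>\<bar>x - y\<bar> \<le> t\<close> grows by a factor of at most \<open>2\<^bsup>n + p\<^esup>\<close> when \<open>t\<close> doubles. Hence the scale
  \<open>\<rho> / 2\<^sup>j\<close> contributes to \<open>\<integral>\<integral>K\<close> at least \<open>2\<^bsup>-jp(1-\<delta>)\<^esup>\<close> times the full left side, up to a factor that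
  does not depend on \<open>j\<close>, and these weights sum to at least \<open>1 / (p (1 - \<delta>))\<close>. Since
  \<open>p\<^bsup>1/p\<^esup>\<close> is bounded, the factor \<open>p\<close> is harmless.

  For the weighted estimate, the inequality on \<open>Q\<^sub>k(x)\<close> bounds \<open>\<bar>A\<^bsub>k+1\<^esub> - A\<^sub>k\<bar>\<^sup>p\<close> at \<open>x\<close> by
  \<open>C p (1 - \<delta>) l\<^sub>k\<^bsup>\<delta>p-n\<^esup>\<close> times the integral of \<open>g\<close> over \<open>Q\<^sub>k(x)\<close>. Lying in the same dyadic cell is
  symmetric, so integration against \<open>w\<close> and Fubini move the average onto the weight:
  the result is \<open>C p (1 - \<delta>) l\<^sub>k\<^bsup>\<epsilon>p\<^esup>\<close> times the integral of \<open>g(y) l\<^sub>k\<^bsup>(\<delta>-\<epsilon>)p\<^esup> w(Q\<^sub>k(y)) / \<bar>Q\<^sub>k(y)\<bar>\<close>, and the factor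
  after \<open>g(y)\<close> is at most the local fractional maximal function. Adding the increments with
  Jensen weights proportional to \<open>2\<^bsup>-k\<epsilon>\<^esup>\<close> costs \<open>1 / (1 - 2\<^bsup>-\<epsilon>\<^esup>) \<le> 2 / \<epsilon>\<close>, which is the factor
  \<open>1 / \<epsilon>\<close> (\<open>weighted_oscillation_le\<close>). Part (b) is the case \<open>\<epsilon> = \<delta>\<close>, where \<open>1 / \<epsilon> < 2\<close> and the
  fractional maximal function is dominated by the ordinary one.
\<close>

section \<open>Convexity of powers\<close>

text \<open>
  From the open half line, convexity extends to the endpoint \<open>0\<close> through
  \<open>(s z)\<^sup>p \<le> s z\<^sup>p\<close> for \<open>s \<le> 1\<close>. The triangle inequality and monotonicity carry it to
  the whole line, so that Jensen's inequality applies to functions that change sign.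
\<close>

lemma abs_powr_convex:
  fixes p :: real
  assumes "1 \<le> p"
  shows "convex_on UNIV (\<lambda>x::real. \<bar>x\<bar> powr p)"
proof (rule convex_onI)
  fix t x y :: real assume t: "0 < t" "t < 1"
  have scale: "(s * z) powr p \<le> s * z powr p" if "0 < s" "s < 1" "0 \<le> z" for s z :: real
  proof -
    have "s powr p \<le> s powr 1"
      using that assms by (intro powr_mono') auto
    then show ?thesis
      using that by (simp add: powr_mult mult_right_mono)
  qed
  have *: "((1 - t) * X + t * Y) powr p \<le> (1 - t) * X powr p + t * Y powr p"
    if "0 \<le> X" "0 \<le> Y" for X Y
  proof -
    consider "X = 0" | "Y = 0" | "X > 0" "Y > 0" using \<open>0 \<le> X\<close> \<open>0 \<le> Y\<close> by linarith
    then show ?thesis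
    proof cases
      case 3
      then show ?thesis
        using convex_onD[OF powr_convex[OF assms], of t X Y] t by simp
    qed (use scale[of t Y] scale[of "1 - t" X] t that assms in auto)
  qed
  have "\<bar>(1 - t) *\<^sub>R x + t *\<^sub>R y\<bar> powr p \<le> ((1 - t) * \<bar>x\<bar> + t * \<bar>y\<bar>) powr p"
    using t assms by (intro powr_mono2) (auto simp: abs_mult intro!: order_trans[OF abs_triangle_ineq])
  also have "\<dots> \<le> (1 - t) * \<bar>x\<bar> powr p + t * \<bar>y\<bar> powr p"
    by (rule *) auto
  finally show "\<bar>(1 - t) *\<^sub>R x + t *\<^sub>R y\<bar> powr p \<le> (1 - t) * \<bar>x\<bar> powr p + t * \<bar>y\<bar> powr p" .
qed simp

lemma abs_add_powr_le:
  fixes a b p :: real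
  assumes "1 \<le> p"
  shows "\<bar>a + b\<bar> powr p \<le> 2 powr p / 2 * (\<bar>a\<bar> powr p + \<bar>b\<bar> powr p)"
  using convex_onD[OF abs_powr_convex[OF assms], of "1/2" "2 * a" "2 * b"]
  by (simp add: abs_mult powr_mult algebra_simps)

text \<open>
  Jensen with weights proportional to \<open>\<theta>\<^sup>k\<close>. The exponent \<open>p - 1\<close> matters: the remaining sum over
  \<open>k\<close> contributes one more factor \<open>1 / (1 - \<theta>)\<close>, and the \<open>p\<close>-th root of the total is then exactly linear
  in \<open>1 / (1 - \<theta>)\<close>.
\<close>

lemma telescope_powr_le:
  fixes A :: "nat \<Rightarrow> real"
  assumes \<theta>: "0 < \<theta>" "\<theta> < 1" and p: "1 \<le> p"
  shows "\<bar>A N - A 0\<bar> powr p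
    \<le> (1 / (1 - \<theta>)) powr (p - 1) * (\<Sum>k<N. \<theta> ^ k * (\<bar>A (Suc k) - A k\<bar> / \<theta> ^ k) powr p)"
proof (cases "N = 0")
  case False
  define S where "S = (\<Sum>k<N. \<theta> ^ k)"
  define b where "b k = \<bar>A (Suc k) - A k\<bar> / \<theta> ^ k" for k
  have S: "0 < S"
    unfolding S_def using False \<theta> by (intro sum_pos) auto
  have S_le: "S \<le> 1 / (1 - \<theta>)"
    unfolding S_def using \<theta> by (subst sum_gp_strict) (auto intro!: divide_right_mono)
  have "\<bar>A N - A 0\<bar> = \<bar>\<Sum>k<N. A (Suc k) - A k\<bar>"
    by (simp add: sum_lessThan_telescope)
  also have "\<dots> \<le> (\<Sum>k<N. \<bar>A (Suc k) - A k\<bar>)"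
    by (rule sum_abs)
  also have "\<dots> = S * (\<Sum>k<N. (\<theta> ^ k / S) * b k)"
    using S \<theta> by (simp add: sum_distrib_left b_def)
  finally have "\<bar>A N - A 0\<bar> powr p \<le> (S * (\<Sum>k<N. (\<theta> ^ k / S) * b k)) powr p"
    using p by (intro powr_mono2) auto
  also have "\<dots> = S powr p * \<bar>\<Sum>k<N. (\<theta> ^ k / S) *\<^sub>R b k\<bar> powr p"
  proof -
    have "0 \<le> (\<Sum>k<N. (\<theta> ^ k / S) * b k)"
      using S \<theta> by (intro sum_nonneg) (auto simp: b_def)
    then show ?thesis
      using S by (simp add: powr_mult)
  qed
  also have "\<dots> \<le> S powr p * (\<Sum>k<N. (\<theta> ^ k / S) * \<bar>b k\<bar> powr p)"
    using S \<theta> False p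
    by (intro mult_left_mono convex_on_sum[OF _ _ abs_powr_convex])
       (auto simp: S_def[symmetric] sum_divide_distrib[symmetric])
  also have "\<dots> = S powr (p - 1) * (\<Sum>k<N. \<theta> ^ k * b k powr p)"
    using S \<theta> by (simp add: powr_diff sum_divide_distrib[symmetric] b_def)
  also have "\<dots> \<le> (1 / (1 - \<theta>)) powr (p - 1) * (\<Sum>k<N. \<theta> ^ k * b k powr p)"
    using S S_le p \<theta> by (intro mult_right_mono powr_mono2 sum_nonneg) auto
  finally show ?thesis
    by (simp add: b_def)
qed (use p in simp)

text \<open>
  Jensen for the uniform measure on \<open>B\<close>. It is used twice in a row to compare two averages, first
  with \<open>c\<close> an average and then with \<open>c\<close> a value of \<open>u\<close>.
\<close>

lemma powr_dist_average_le:
  fixes u :: "'a::euclidean_space \<Rightarrow> real"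
  assumes [measurable]: "u \<in> borel_measurable borel" "B \<in> sets borel" and p: "1 \<le> p"
    and B: "emeasure lborel B = ennreal b" "0 < b" and int: "set_integrable lborel B u"
  shows "ennreal (\<bar>c - (LINT y:B|lborel. u y) / b\<bar> powr p)
    \<le> ennreal (1 / b) * (\<integral>\<^sup>+y\<in>B. ennreal (\<bar>c - u y\<bar> powr p) \<partial>lborel)"
proof (cases "(\<integral>\<^sup>+y\<in>B. ennreal (\<bar>c - u y\<bar> powr p) \<partial>lborel) = \<infinity>")
  case True
  then show ?thesis using B by (simp add: ennreal_mult_top)
next
  case False
  define M where "M = uniform_measure lborel B"
  interpret M: prob_space M
    unfolding M_def using B by (intro prob_space_uniform_measure) auto
  have M: "M = density lborel (\<lambda>x. ennreal (indicator B x / b))"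
    unfolding M_def uniform_measure_def using B
    by (intro density_cong) (auto simp: indicator_def divide_ennreal[symmetric])
  have [simp]: "sets M = sets borel"
    by (simp add: M)
  have iM: "integrable M f \<longleftrightarrow> set_integrable lborel B f" "(\<integral>x. f x \<partial>M) = (LINT x:B|lborel. f x) / b"
    if [measurable]: "f \<in> borel_measurable borel" for f :: "'a \<Rightarrow> real"
  proof -
    have "integrable M f \<longleftrightarrow> integrable lborel (\<lambda>x. (1 / b) * (indicator B x * f x))"
      unfolding M using B by (subst integrable_density) auto
    then show "integrable M f \<longleftrightarrow> set_integrable lborel B f"
      using B integrable_mult_left_iff[of lborel "1 / b" "\<lambda>x. indicator B x * f x"] by (simp add: set_integrable_def)
    have "(\<integral>x. f x \<partial>M) = (\<integral>x. (indicator B x * f x) / b \<partial>lborel)"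
      unfolding M using B by (subst integral_density) auto
    then show "(\<integral>x. f x \<partial>M) = (LINT x:B|lborel. f x) / b"
      by (simp add: set_lebesgue_integral_def)
  qed
  have int_p: "set_integrable lborel B (\<lambda>y. \<bar>c - u y\<bar> powr p)"
    unfolding set_integrable_def
  proof (intro integrableI_nonneg)
    have "(\<integral>\<^sup>+y. ennreal (indicator B y *\<^sub>R \<bar>c - u y\<bar> powr p) \<partial>lborel) = (\<integral>\<^sup>+y\<in>B. ennreal (\<bar>c - u y\<bar> powr p) \<partial>lborel)"
      by (intro nn_integral_cong) (simp add: indicator_def)
    then show "(\<integral>\<^sup>+y. ennreal (indicator B y *\<^sub>R \<bar>c - u y\<bar> powr p) \<partial>lborel) < \<infinity>"
      using False by (simp add: less_top)
  qed auto
  have u: "integrable M u"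
    using int iM(1) by simp
  have "\<bar>M.expectation (\<lambda>y. c - u y)\<bar> powr p \<le> M.expectation (\<lambda>y. \<bar>c - u y\<bar> powr p)"
    by (rule M.jensens_inequality[where I=UNIV and q="\<lambda>t. \<bar>t\<bar> powr p"])
       (use u int_p iM(1) abs_powr_convex[OF p] in auto)
  also have "M.expectation (\<lambda>y. c - u y) = c - (LINT y:B|lborel. u y) / b"
    using u by (simp add: iM(2) M.prob_space)
  also have "M.expectation (\<lambda>y. \<bar>c - u y\<bar> powr p) = (LINT y:B|lborel. \<bar>c - u y\<bar> powr p) / b"
    by (simp add: iM(2))
  finally have "ennreal (\<bar>c - (LINT y:B|lborel. u y) / b\<bar> powr p)
      \<le> ennreal (1 / b) * ennreal (LINT y:B|lborel. \<bar>c - u y\<bar> powr p)"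
    using B by (subst ennreal_mult'[symmetric]) (auto intro: ennreal_leI)
  also have "ennreal (LINT y:B|lborel. \<bar>c - u y\<bar> powr p) = (\<integral>\<^sup>+y\<in>B. ennreal (\<bar>c - u y\<bar> powr p) \<partial>lborel)"
    unfolding set_lebesgue_integral_def
    using int_p by (subst nn_integral_eq_integral[symmetric])
      (auto simp: set_integrable_def indicator_def intro!: nn_integral_cong)
  finally show ?thesis .
qed

section \<open>A fractional Poincare inequality on convex sets\<close>

text \<open>
  The layers \<open>r \<le> \<rho> / 2\<^sup>j\<close> that contain \<open>r\<close> carry geometrically growing weights, so their sum is
  comparable to the last one, which is at most \<open>(\<rho> / r)\<^sup>s\<close>. This lets a singular kernel be bounded below
  by a sum over scales.
\<close>

lemma geometric_sum_indicator_le: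
  fixes r \<rho> s :: real
  assumes "0 < r" "0 < \<rho>" "1 \<le> s"
  shows "(\<Sum>j<N. 2 powr (real j * s) * indicator {..\<rho> / 2 ^ j} r) \<le> 2 * (\<rho> / r) powr s"
proof (induction N)
  case 0
  then show ?case using assms by simp
next
  case (Suc N)
  have geo: "(\<Sum>j\<le>M. 2 powr (real j * s)) \<le> 2 * 2 powr (real M * s)" for M :: nat
  proof (induction M)
    case (Suc M)
    have "2 powr (real M * s) * 2 powr 1 \<le> 2 powr (real M * s) * 2 powr s"
      using assms by (intro mult_left_mono powr_mono) auto
    also have "\<dots> = 2 powr (real (Suc M) * s)"
      by (simp add: powr_add[symmetric] algebra_simps)
    finally show ?case using Suc by simp
  qed simp
  show ?case
  proof (cases "r \<le> \<rho> / 2 ^ N")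
    case False
    then show ?thesis using Suc by simp
  next
    case True
    have "(\<Sum>j<Suc N. 2 powr (real j * s) * indicator {..\<rho> / 2 ^ j} r) \<le> (\<Sum>j\<le>N. 2 powr (real j * s))"
      unfolding lessThan_Suc_atMost by (intro sum_mono) (auto simp: indicator_def)
    also have "\<dots> \<le> 2 * (2 ^ N) powr s"
      using geo[of N] by (simp add: powr_powr[symmetric] powr_realpow)
    also have "\<dots> \<le> 2 * (\<rho> / r) powr s"
      using True assms by (intro mult_left_mono powr_mono2) (auto simp: field_simps)
    finally show ?thesis .
  qed
qed

lemma nn_integral_lborel_affine:
  fixes f :: "'a::euclidean_space \<Rightarrow> ennreal"
  assumes [measurable]: "f \<in> borel_measurable borel" and c: "c \<noteq> 0"
  shows "(\<integral>\<^sup>+x. f x \<partial>lborel) = ennreal (\<bar>c\<bar> ^ DIM('a)) * (\<integral>\<^sup>+x. f (t + c *\<^sub>R x) \<partial>lborel)"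
  by (subst lborel_affine[OF c, of t])
     (simp add: nn_integral_density nn_integral_distr nn_integral_cmult)

definition near_osc :: "real \<Rightarrow> 'a::euclidean_space set \<Rightarrow> ('a \<Rightarrow> real) \<Rightarrow> real \<Rightarrow> ennreal" where
  "near_osc p Q u t = (\<integral>\<^sup>+x. \<integral>\<^sup>+y. indicator Q x * indicator Q y * indicator {..t} (norm (x - y))
      * ennreal (\<bar>u x - u y\<bar> powr p) \<partial>lborel \<partial>lborel)"

text \<open>
  Compare \<open>u x\<close> and \<open>u y\<close> with the value at the midpoint \<open>z\<close>, which lies in \<open>Q\<close> by convexity. The two
  resulting terms are equal by symmetry, and for fixed \<open>x\<close> the substitution \<open>y \<mapsto> z\<close> halves the
  distance and gives \<open>dy = 2\<^sup>n dz\<close>.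
\<close>

lemma near_osc_double:
  fixes u :: "'a::euclidean_space \<Rightarrow> real"
  assumes [measurable]: "u \<in> borel_measurable borel" "Q \<in> sets borel" and "convex Q" "1 \<le> p"
  shows "near_osc p Q u (2 * t) \<le> ennreal (2 powr (real DIM('a) + p)) * near_osc p Q u t"
proof -
  define F :: "'a \<Rightarrow> 'a \<Rightarrow> ennreal" where "F x y = indicator Q x * indicator Q y * indicator {..t} (norm (x - y))
      * ennreal (\<bar>u x - u y\<bar> powr p)" for x y
  have [measurable]: "(\<lambda>(x, y). F x y) \<in> borel_measurable (borel \<Otimes>\<^sub>M borel)"
    unfolding F_def by measurable
  define m where "m x y = (1/2) *\<^sub>R x + (1/2) *\<^sub>R y" for x y :: 'a
  have [measurable]: "(\<lambda>(x, y). m x y) \<in> borel_measurable (borel \<Otimes>\<^sub>M borel)"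
    unfolding m_def by measurable
  have sub: "(\<integral>\<^sup>+y. F x (m x y) \<partial>lborel) = ennreal (2 ^ DIM('a)) * (\<integral>\<^sup>+z. F x z \<partial>lborel)" for x
  proof -
    have "(\<integral>\<^sup>+z. F x z \<partial>lborel) = ennreal ((1/2) ^ DIM('a)) * (\<integral>\<^sup>+y. F x (m x y) \<partial>lborel)"
      unfolding m_def by (subst nn_integral_lborel_affine[of _ "1/2" "(1/2) *\<^sub>R x"]) simp_all
    then show ?thesis
      by (simp add: mult.assoc[symmetric] ennreal_mult[symmetric] power_mult_distrib[symmetric])
  qed
  have pw: "indicator Q x * indicator Q y * indicator {..2 * t} (norm (x - y)) * ennreal (\<bar>u x - u y\<bar> powr p)
      \<le> ennreal (2 powr p / 2) * (F x (m x y) + F y (m x y))" (is "?L \<le> ?R") for x y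
  proof (cases "x \<in> Q \<and> y \<in> Q \<and> norm (x - y) \<le> 2 * t")
    case True
    have m: "m x y \<in> Q"
      unfolding m_def using True \<open>convex Q\<close> by (intro convexD) auto
    have "x - m x y = (1/2) *\<^sub>R (x - y)" "y - m x y = (-(1/2)) *\<^sub>R (x - y)"
      unfolding m_def by (simp_all add: algebra_simps scaleR_left.add[symmetric])
    then have n: "norm (x - m x y) \<le> t" "norm (y - m x y) \<le> t"
      using True by auto
    have "\<bar>u x - u y\<bar> powr p \<le> 2 powr p / 2 * (\<bar>u x - u (m x y)\<bar> powr p + \<bar>u y - u (m x y)\<bar> powr p)"
      using abs_add_powr_le[OF \<open>1 \<le> p\<close>, of "u x - u (m x y)" "u (m x y) - u y"]
      by (simp add: abs_minus_commute)
    then show ?thesis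
      using True m n by (simp add: F_def ennreal_plus[symmetric] ennreal_mult'[symmetric] del: ennreal_plus)
  qed (auto simp: indicator_def)
  have swap: "(\<integral>\<^sup>+x. \<integral>\<^sup>+y. F y (m x y) \<partial>lborel \<partial>lborel) = (\<integral>\<^sup>+x. \<integral>\<^sup>+y. F x (m x y) \<partial>lborel \<partial>lborel)"
    using lborel_pair.Fubini'[of "\<lambda>x y. F y (m x y)"] by (simp add: m_def add.commute)
  have "near_osc p Q u (2 * t) \<le> (\<integral>\<^sup>+x. \<integral>\<^sup>+y. ennreal (2 powr p / 2) * (F x (m x y) + F y (m x y)) \<partial>lborel \<partial>lborel)"
    unfolding near_osc_def by (intro nn_integral_mono pw)
  also have "\<dots> = ennreal (2 powr p / 2) * ((\<integral>\<^sup>+x. \<integral>\<^sup>+y. F x (m x y) \<partial>lborel \<partial>lborel) + (\<integral>\<^sup>+x. \<integral>\<^sup>+y. F y (m x y) \<partial>lborel \<partial>lborel))"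
    by (simp add: nn_integral_cmult nn_integral_add)
  also have "\<dots> = ennreal (2 powr p / 2) * (2 * (ennreal (2 ^ DIM('a)) * near_osc p Q u t))"
    unfolding swap sub near_osc_def F_def[symmetric] by (simp add: nn_integral_cmult mult_2)
  also have "\<dots> = (ennreal (2 powr p / 2) * ennreal 2 * ennreal (2 ^ DIM('a))) * near_osc p Q u t"
    by (simp add: mult.assoc)
  also have "ennreal (2 powr p / 2) * ennreal 2 * ennreal (2 ^ DIM('a)) = ennreal (2 powr (real DIM('a) + p))"
    by (subst ennreal_mult'[symmetric], simp)+ (simp add: powr_add powr_realpow)
  finally show ?thesis .
qed

lemma one_minus_two_powr_le:
  fixes x :: real assumes "0 \<le> x" shows "1 - 2 powr - x \<le> x"
proof -
  have "1 + (- x * ln 2) \<le> 2 powr - x"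
    using exp_ge_add_one_self[of "- x * ln 2"] by (simp add: powr_def)
  moreover have "x * ln 2 \<le> x * 1"
    using assms ln_le_minus_one[of 2] by (intro mult_left_mono) auto
  ultimately show ?thesis by simp
qed

text \<open>
  Summing the doubling estimate over all scales \<open>\<rho> / 2\<^sup>j\<close> gives the geometric series with ratio
  \<open>q = 2\<^bsup>-p(1-\<delta>)\<^esup>\<close>. Its sum is at least \<open>1 / (p (1 - \<delta>))\<close>, which is where the gain as \<open>\<delta>\<close> tends to
  \<open>1\<close> comes from.
\<close>

lemma fractional_poincare_convex:
  fixes u :: "'a::euclidean_space \<Rightarrow> real"
  assumes [measurable]: "u \<in> borel_measurable borel" "Q \<in> sets borel" and Q: "convex Q" and p: "1 \<le> p"
    and \<delta>: "0 < \<delta>" "\<delta> < 1" and \<rho>: "0 < \<rho>" and diam: "\<And>x y. x \<in> Q \<Longrightarrow> y \<in> Q \<Longrightarrow> norm (x - y) \<le> \<rho>"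
  shows "(\<integral>\<^sup>+x\<in>Q. (\<integral>\<^sup>+y\<in>Q. ennreal (\<bar>u x - u y\<bar> powr p) \<partial>lborel) \<partial>lborel)
    \<le> ennreal (2 * \<rho> powr (real DIM('a) + \<delta> * p) * (p * (1 - \<delta>)))
      * (\<integral>\<^sup>+x\<in>Q. (\<integral>\<^sup>+y\<in>Q. ennreal (\<bar>u x - u y\<bar> powr p / norm (x - y) powr (real DIM('a) + \<delta> * p)) \<partial>lborel) \<partial>lborel)"
    (is "?G \<le> _ * ?I")
proof -
  define s where "s = real DIM('a) + \<delta> * p"
  have s: "1 \<le> s"
    using DIM_positive[where 'a='a] \<delta> p unfolding s_def by (smt (verit) mult_nonneg_nonneg of_nat_1 of_nat_le_iff Suc_leI One_nat_def)
  define G where "G = near_osc p Q u"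
  define q where "q = 2 powr - (p * (1 - \<delta>))"
  have q: "0 < q" "q < 1"
    using p \<delta> by (auto simp: q_def powr_less_one)
  have G\<rho>: "?G = G \<rho>"
    unfolding G_def near_osc_def
    by (auto simp: nn_integral_multc[symmetric] indicator_def diam intro!: nn_integral_cong)
  have G_scale: "G \<rho> \<le> ennreal (2 powr (real j * (real DIM('a) + p))) * G (\<rho> / 2 ^ j)" for j
  proof (induction j)
    case (Suc j)
    have "G (\<rho> / 2 ^ j) \<le> ennreal (2 powr (real DIM('a) + p)) * G (\<rho> / 2 ^ Suc j)"
      unfolding G_def using near_osc_double[OF assms(1-4), of "\<rho> / 2 ^ Suc j"] by simp
    then have "G \<rho> \<le> ennreal (2 powr (real j * (real DIM('a) + p)))
        * (ennreal (2 powr (real DIM('a) + p)) * G (\<rho> / 2 ^ Suc j))"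
      using Suc by (meson mult_left_mono order_trans zero_le)
    also have "\<dots> = ennreal (2 powr (real (Suc j) * (real DIM('a) + p))) * G (\<rho> / 2 ^ Suc j)"
      by (simp add: mult.assoc[symmetric] ennreal_mult[symmetric] powr_add[symmetric] algebra_simps)
    finally show ?case .
  qed simp
  have pw: "(\<Sum>j<N. ennreal (2 powr (real j * s)) * (indicator Q x * indicator Q y * indicator {..\<rho> / 2 ^ j} (norm (x - y))
        * ennreal (\<bar>u x - u y\<bar> powr p)))
      \<le> ennreal (2 * \<rho> powr s) * (ennreal (\<bar>u x - u y\<bar> powr p / norm (x - y) powr s) * indicator Q y * indicator Q x)"
    (is "?L \<le> ?R") for N x y
  proof (cases "x \<in> Q \<and> y \<in> Q \<and> x \<noteq> y")
    case True
    have "?L = (\<Sum>j<N. ennreal (2 powr (real j * s) * indicator {..\<rho> / 2 ^ j} (norm (x - y)) * \<bar>u x - u y\<bar> powr p))"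
      using True by (auto simp: indicator_def ennreal_mult' intro!: sum.cong)
    also have "\<dots> = ennreal ((\<Sum>j<N. 2 powr (real j * s) * indicator {..\<rho> / 2 ^ j} (norm (x - y))) * \<bar>u x - u y\<bar> powr p)"
      unfolding sum_distrib_right by (rule sum_ennreal) simp
    also have "\<dots> \<le> ennreal (2 * (\<rho> / norm (x - y)) powr s * \<bar>u x - u y\<bar> powr p)"
      using True s \<rho> by (intro ennreal_leI mult_right_mono geometric_sum_indicator_le) auto
    also have "\<dots> = ?R"
      using True \<rho> by (simp add: powr_divide ennreal_mult'[symmetric] mult.assoc)
    finally show ?thesis .
  qed (auto simp: indicator_def)
  \<comment> \<open>Exchange of the sum over scales with the double integral.\<close>
  have partial: "(\<Sum>j<N. ennreal (q ^ j) * G \<rho>) \<le> ennreal (2 * \<rho> powr s) * ?I" for N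
  proof -
    have "(\<Sum>j<N. ennreal (q ^ j) * G \<rho>) \<le> (\<Sum>j<N. ennreal (2 powr (real j * s)) * G (\<rho> / 2 ^ j))"
    proof (rule sum_mono)
      fix j
      have "ennreal (q ^ j) * G \<rho> \<le> ennreal (q ^ j) * (ennreal (2 powr (real j * (real DIM('a) + p))) * G (\<rho> / 2 ^ j))"
        by (intro mult_left_mono G_scale) simp
      also have "\<dots> = ennreal (q ^ j * 2 powr (real j * (real DIM('a) + p))) * G (\<rho> / 2 ^ j)"
        using q by (simp add: ennreal_mult mult.assoc)
      also have "q ^ j * 2 powr (real j * (real DIM('a) + p)) = 2 powr (real j * s)"
      proof -
        have "q ^ j = 2 powr (- (real j * (p * (1 - \<delta>))))"
        by (simp add: q_def powr_realpow[symmetric] powr_powr mult.commute)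
        then show ?thesis
          by (simp add: powr_add[symmetric] s_def algebra_simps)
      qed
      finally show "ennreal (q ^ j) * G \<rho> \<le> ennreal (2 powr (real j * s)) * G (\<rho> / 2 ^ j)" .
    qed
    also have "\<dots> = (\<integral>\<^sup>+x. \<integral>\<^sup>+y. (\<Sum>j<N. ennreal (2 powr (real j * s)) * (indicator Q x * indicator Q y
        * indicator {..\<rho> / 2 ^ j} (norm (x - y)) * ennreal (\<bar>u x - u y\<bar> powr p))) \<partial>lborel \<partial>lborel)"
      by (simp add: G_def near_osc_def nn_integral_sum nn_integral_cmult)
    also have "\<dots> \<le> (\<integral>\<^sup>+x. \<integral>\<^sup>+y. ennreal (2 * \<rho> powr s) * (ennreal (\<bar>u x - u y\<bar> powr p / norm (x - y) powr s)
        * indicator Q y * indicator Q x) \<partial>lborel \<partial>lborel)"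
      by (intro nn_integral_mono pw)
    also have "\<dots> = ennreal (2 * \<rho> powr s) * ?I"
      by (simp add: nn_integral_cmult nn_integral_multc s_def)
    finally show ?thesis .
  qed
  have "(\<Sum>j. ennreal (q ^ j)) = ennreal (1 / (1 - q))"
    using geometric_sums[of q] q by (intro suminf_ennreal_eq) auto
  then have "ennreal (1 / (1 - q)) * G \<rho> = (\<Sum>j. ennreal (q ^ j) * G \<rho>)"
    by (simp add: ennreal_suminf_multc)
  also have "\<dots> \<le> ennreal (2 * \<rho> powr s) * ?I"
    using partial by (intro suminf_le_const) auto
  finally have "ennreal (1 - q) * (ennreal (1 / (1 - q)) * G \<rho>) \<le> ennreal (1 - q) * (ennreal (2 * \<rho> powr s) * ?I)"
    by (rule mult_left_mono) simp
  moreover have "ennreal (1 - q) * (ennreal (1 / (1 - q)) * G \<rho>) = G \<rho>"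
    using q by (simp add: mult.assoc[symmetric] ennreal_mult[symmetric])
  ultimately have "G \<rho> \<le> ennreal (1 - q) * (ennreal (2 * \<rho> powr s) * ?I)" by simp
  also have "\<dots> \<le> ennreal (p * (1 - \<delta>)) * (ennreal (2 * \<rho> powr s) * ?I)"
    using one_minus_two_powr_le[of "p * (1 - \<delta>)"] p \<delta>
    by (intro mult_right_mono ennreal_leI) (auto simp: q_def)
  also have "\<dots> = ennreal (2 * \<rho> powr s * (p * (1 - \<delta>))) * ?I"
    using p \<delta> by (simp add: ennreal_mult' ac_simps)
  finally show ?thesis
    unfolding G\<rho> s_def .
qed

section \<open>Cubes and their dyadic cells\<close>

lemma norm_le_sqrt_card:
  fixes x :: "real ^ 'n"
  assumes "\<And>i. \<bar>x $ i\<bar> \<le> r"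
  shows "norm x \<le> sqrt (real CARD('n)) * r"
proof -
  have r: "0 \<le> r"
    using assms[of undefined] by linarith
  have "norm x \<le> L2_set (\<lambda>i. r) (UNIV :: 'n set)"
    unfolding norm_vec_def using assms by (intro L2_set_mono) auto
  also have "\<dots> = sqrt (real CARD('n)) * r"
    using r by (simp add: L2_set_constant)
  finally show ?thesis .
qed

text \<open>
  Every cube lies between an open and a closed box with the same volume. Each interval factor is an
  open interval together with at most two endpoints, so it is Borel and convex whichever endpoints it
  contains.
\<close>

lemma cube_of_side_facts:
  fixes R :: "(real ^ 'n) set"
  assumes "cube_of_side R r"
  shows cube_side_pos: "0 < r"
    and cube_borel: "R \<in> sets borel"
    and cube_emeasure: "emeasure lborel R = ennreal (r powr real CARD('n))"
    and cube_convex: "convex R"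
    and cube_bounded: "bounded R"
    and cube_diameter: "\<And>x y. x \<in> R \<Longrightarrow> y \<in> R \<Longrightarrow> norm (x - y) \<le> sqrt (real CARD('n)) * r"
proof -
  have r: "0 < r"
    and "\<exists>I a. (\<forall>i. {a i<..<a i + r} \<subseteq> I i \<and> I i \<subseteq> {a i..a i + r}) \<and> R = {x. \<forall>i. x $ i \<in> I i}"
    using assms by (auto simp only: cube_of_side_def)
  then obtain I a
    where IR: "(\<forall>i. {a i<..<a i + r} \<subseteq> I i \<and> I i \<subseteq> {a i..a i + r}) \<and> R = {x. \<forall>i. x $ i \<in> I i}"
    by (elim exE) (rule that)
  from IR have I: "{a i<..<a i + r} \<subseteq> I i" "I i \<subseteq> {a i..a i + r}" for i
    by simp_all
  from IR have R: "R = {x. \<forall>i. x $ i \<in> I i}"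
    by simp
  show "0 < r" by fact
  have Ieq: "I i = {a i<..<a i + r} \<union> (I i \<inter> {a i, a i + r})" for i
  proof
    show "I i \<subseteq> {a i<..<a i + r} \<union> (I i \<inter> {a i, a i + r})"
    proof
      fix t assume "t \<in> I i"
      moreover from this have "a i \<le> t" "t \<le> a i + r"
        using I(2)[of i] by auto
      ultimately show "t \<in> {a i<..<a i + r} \<union> (I i \<inter> {a i, a i + r})"
        by auto
    qed
  qed (use I in auto)
  have [measurable]: "I i \<in> sets borel" for i
  proof -
    have "I i \<inter> {a i, a i + r} \<in> sets borel"
      by (intro borel_closed finite_imp_closed) simp
    then show ?thesis
      by (subst Ieq) simp
  qed
  have "R = (\<Inter>i. (\<lambda>x. x $ i) -` I i)"
    by (auto simp: R)
  also have "\<dots> \<in> sets borel"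
  proof (intro sets.countable_INT'')
    fix i
    have "(\<lambda>x :: real ^ 'n. x $ i) \<in> borel_measurable borel"
      by (intro borel_measurable_continuous_onI continuous_intros)
    then show "(\<lambda>x :: real ^ 'n. x $ i) -` I i \<in> sets borel"
      by (rule measurable_sets_borel) measurable
  qed auto
  finally show R_borel: "R \<in> sets borel" .
  define A where "A = (\<chi> i. a i)"
  define B where "B = (\<chi> i. a i + r)"
  have sub: "box A B \<subseteq> R" "R \<subseteq> cbox A B"
    using I unfolding R A_def B_def by (fastforce simp: mem_box_cart subset_eq)+
  have le: "\<And>b. b \<in> Basis \<Longrightarrow> A \<bullet> b \<le> B \<bullet> b"
    using r by (auto simp: A_def B_def Basis_vec_def inner_axis)
  have prod: "(\<Prod>b\<in>Basis. (B - A) \<bullet> b) = r powr real CARD('n)"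
  proof -
    have "(\<Prod>b\<in>Basis. (B - A) \<bullet> b) = (\<Prod>b\<in>(Basis :: (real ^ 'n) set). r)"
      by (intro prod.cong) (auto simp: A_def B_def Basis_vec_def inner_axis)
    then show ?thesis using r by (simp add: powr_realpow)
  qed
  have "emeasure lborel (box A B) = ennreal (r powr real CARD('n))"
    "emeasure lborel (cbox A B) = ennreal (r powr real CARD('n))"
    using le by (simp_all add: emeasure_lborel_box_eq emeasure_lborel_cbox_eq prod)
  then show "emeasure lborel R = ennreal (r powr real CARD('n))"
    using emeasure_mono[OF sub(1), of lborel] emeasure_mono[OF sub(2), of lborel] R_borel by simp
  show "bounded R"
    using sub(2) bounded_cbox bounded_subset by blast
  show "convex R"
  proof (rule convexI)
    fix x y s t assume xy: "x \<in> R" "y \<in> R" and st: "0 \<le> s" "0 \<le> t" "s + t = (1::real)"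
    have "s * x $ i + t * y $ i \<in> I i" for i
    proof -
      have "is_interval (I i)"
        unfolding is_interval_1
      proof (intro ballI allI impI)
        fix y z t assume yz: "y \<in> I i" "z \<in> I i" and t: "y \<le> t \<and> t \<le> z"
        have "a i \<le> y" "z \<le> a i + r"
          using yz I(2)[of i] by auto
        then consider "t = y" | "t = z" | "t \<in> {a i<..<a i + r}"
          using t by fastforce
        then show "t \<in> I i"
          using yz I(1)[of i] by cases auto
      qed
      then show ?thesis
        using xy st convexD[of "I i" "x $ i" "y $ i" s t] by (auto simp: R is_interval_convex_1)
    qed
    then show "s *\<^sub>R x + t *\<^sub>R y \<in> R" by (simp add: R)
  qed
  show "norm (x - y) \<le> sqrt (real CARD('n)) * r" if "x \<in> R" "y \<in> R" for x y
  proof (rule norm_le_sqrt_card)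
    fix i
    have "x $ i \<in> {a i..a i + r}" "y $ i \<in> {a i..a i + r}"
      using that I(2)[of i] by (auto simp: R)
    then show "\<bar>(x - y) $ i\<bar> \<le> r"
      by auto
  qed
qed

text \<open>
  The number of the dyadic interval of length \<open>l / 2\<^sup>k\<close> containing \<open>t\<close>. The right endpoint \<open>a + l\<close> would
  receive the number \<open>2\<^sup>k\<close> and form a degenerate interval of its own; the minimum puts it into the last
  interval, so that the cells of a cube are again cubes, whichever of its faces it contains.
\<close>

definition dyadic_index :: "real \<Rightarrow> real \<Rightarrow> nat \<Rightarrow> real \<Rightarrow> int" where
  "dyadic_index a l k t = min \<lfloor>2 ^ k * ((t - a) / l)\<rfloor> (2 ^ k - 1)"

text \<open>
  Halving the number gives the number of the parent interval; this is the nestedness of the grids.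
\<close>

lemma dyadic_index_Suc: "dyadic_index a l k t = dyadic_index a l (Suc k) t div 2"
proof -
  have "\<lfloor>2 ^ k * ((t - a) / l)\<rfloor> = \<lfloor>2 ^ Suc k * ((t - a) / l)\<rfloor> div 2"
    using floor_divide_real_eq_div[of 2 "2 ^ Suc k * ((t - a) / l)"] by simp
  moreover have "min (F div 2) (M - 1) = min F (2 * M - 1) div 2" for F M :: int
    by (auto simp: min_def)
  ultimately show ?thesis
    unfolding dyadic_index_def by simp
qed

locale cube_grid =
  fixes Q :: "(real ^ 'n) set" and I :: "'n \<Rightarrow> real set" and a :: "'n \<Rightarrow> real" and l :: real
  assumes l_pos: "0 < l" and I_lower: "{a i<..<a i + l} \<subseteq> I i" and I_upper: "I i \<subseteq> {a i..a i + l}"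
    and Q_eq: "Q = {x. \<forall>i. x $ i \<in> I i}"
begin

text \<open>
  A cell is an equivalence class, named by any of its points instead of by its index. The symmetry
  of the relation then replaces sums over the cells of a generation by a single use of Fubini.
\<close>

definition cell :: "nat \<Rightarrow> real ^ 'n \<Rightarrow> (real ^ 'n) set" where
  "cell k x = {y \<in> Q. \<forall>i. dyadic_index (a i) l k (y $ i) = dyadic_index (a i) l k (x $ i)}"

lemma Q_cube: "cube_of_side Q l"
  unfolding cube_of_side_def using l_pos I_lower I_upper Q_eq
  by (intro conjI exI[of _ I] exI[of _ a]) simp_all

lemma Q_borel [measurable]: "Q \<in> sets borel"
  using cube_borel[OF Q_cube] .

lemma cell_subset: "cell k x \<subseteq> Q"
  by (auto simp: cell_def)

lemma self_in_cell: "x \<in> Q \<Longrightarrow> x \<in> cell k x"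
  by (simp add: cell_def)

lemma cell_sym: "x \<in> Q \<Longrightarrow> y \<in> cell k x \<longleftrightarrow> y \<in> Q \<and> x \<in> cell k y"
  by (auto simp: cell_def)

lemma cell_Suc_subset: "cell (Suc k) x \<subseteq> cell k x"
  by (auto simp: cell_def dyadic_index_Suc[of _ _ k])

lemma cell_cube:
  assumes "x \<in> Q"
  shows "cube_of_side (cell k x) (l / 2 ^ k)"
proof -
  define h where "h = l / 2 ^ k"
  define m where "m i = dyadic_index (a i) l k (x $ i)" for i
  define c where "c i = a i + m i * h" for i
  define J where "J i = {t \<in> I i. dyadic_index (a i) l k t = m i}" for i
  have h: "0 < h" "2 ^ k * h = l"
    using l_pos by (simp_all add: h_def)
  have rescale: "2 ^ k * ((t - a i) / l) = (t - a i) / h" for t i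
    by (simp add: h_def)
  have in_I: "x $ i \<in> I i" for i
    using assms by (simp add: Q_eq)
  have m: "0 \<le> m i" "m i \<le> 2 ^ k - 1" for i
    using in_I[of i] I_upper[of i] l_pos by (auto simp: m_def dyadic_index_def)
  have m_real: "real_of_int (m i) + 1 \<le> 2 ^ k" for i
  proof -
    have "real_of_int (m i + 1) \<le> real_of_int (2 ^ k)"
      unfolding of_int_le_iff using m(2)[of i] by simp
    then show ?thesis by simp
  qed
  have below: "a i \<le> c i" for i
    using m(1)[of i] h by (simp add: c_def)
  have above: "c i + h \<le> a i + l" for i
  proof -
    have "(real_of_int (m i) + 1) * h \<le> 2 ^ k * h"
      using m_real[of i] h by (intro mult_right_mono) auto
    then show ?thesis
      unfolding h(2) by (simp add: c_def distrib_right)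
  qed
  have "{c i<..<c i + h} \<subseteq> J i" for i
  proof
    fix t assume t: "t \<in> {c i<..<c i + h}"
    have "real_of_int (m i) \<le> (t - a i) / h" "(t - a i) / h < real_of_int (m i) + 1"
      using t h(1) by (simp_all add: c_def pos_le_divide_eq pos_divide_less_eq distrib_right)
    then have "\<lfloor>2 ^ k * ((t - a i) / l)\<rfloor> = m i"
      unfolding rescale by (rule floor_unique)
    moreover have "t \<in> I i"
      using t below[of i] above[of i] I_lower[of i] by (auto simp: subset_eq)
    ultimately show "t \<in> J i"
      using m(2)[of i] by (simp add: J_def dyadic_index_def)
  qed
  moreover have "J i \<subseteq> {c i..c i + h}" for i
  proof
    fix t assume t: "t \<in> J i"
    define r where "r = (t - a i) / h"
    have "t \<le> a i + l"
      using t I_upper[of i] by (auto simp: J_def)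
    then have r_le: "r \<le> 2 ^ k"
      using h by (simp add: r_def pos_divide_le_eq)
    have "min \<lfloor>r\<rfloor> (2 ^ k - 1) = m i"
      using t unfolding J_def dyadic_index_def rescale r_def by simp
    then consider "m i = \<lfloor>r\<rfloor>" | "m i = 2 ^ k - 1" "m i \<le> \<lfloor>r\<rfloor>"
      by linarith
    then have "real_of_int (m i) \<le> r \<and> r \<le> real_of_int (m i) + 1"
    proof cases
      case 1
      then show ?thesis by linarith
    next
      case 2
      from 2(1) have "real_of_int (m i) = 2 ^ k - 1" by simp
      moreover have "real_of_int (m i) \<le> r"
        using 2(2) by (simp add: le_floor_iff)
      ultimately show ?thesis
        using r_le by simp
    qed
    then show "t \<in> {c i..c i + h}"
      using h(1) by (simp add: c_def r_def pos_le_divide_eq pos_divide_le_eq distrib_right)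
  qed
  moreover have "cell k x = {y. \<forall>i. y $ i \<in> J i}"
  proof -
    have "y \<in> Q \<longleftrightarrow> (\<forall>i. y $ i \<in> I i)" for y
      by (subst Q_eq) simp
    then show ?thesis
      by (auto simp: cell_def J_def m_def)
  qed
  ultimately have "(\<forall>i. {c i<..<c i + h} \<subseteq> J i \<and> J i \<subseteq> {c i..c i + h}) \<and> cell k x = {y. \<forall>i. y $ i \<in> J i}"
    by simp
  then show ?thesis
    unfolding cube_of_side_def h_def[symmetric] using h(1)
    by (intro conjI exI[of _ J] exI[of _ c]) simp_all
qed

lemma cell_0: "x \<in> Q \<Longrightarrow> cell 0 x = Q"
proof -
  have "dyadic_index (a i) l 0 (y $ i) = 0" if "y \<in> Q" for y i
    using that I_upper[of i] l_pos by (auto simp: Q_eq dyadic_index_def subset_eq)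
  then show "x \<in> Q \<Longrightarrow> cell 0 x = Q"
    by (auto simp: cell_def)
qed

text \<open>
  Joint measurability in the two points is what Fubini requires.
\<close>

lemma cell_pred_measurable [measurable]:
  "(\<lambda>(x, y). y \<in> cell k x) \<in> measurable (borel \<Otimes>\<^sub>M borel) (count_space UNIV)"
proof -
  have comp: "(\<lambda>x :: real ^ 'n. x $ i) \<in> borel_measurable borel" for i
    by (intro borel_measurable_continuous_onI continuous_intros)
  have fl: "(\<lambda>t :: real. \<lfloor>2 ^ k * ((t - b) / l)\<rfloor>) \<in> measurable borel (count_space UNIV)" for b
    by measurable
  have "(\<lambda>t. min \<lfloor>2 ^ k * ((t - b) / l)\<rfloor> (2 ^ k - 1)) \<in> measurable borel (count_space UNIV)" for b
    by (rule measurable_compose[OF fl, where g="\<lambda>z. min z (2 ^ k - 1)"]) simp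
  then have "dyadic_index b l k \<in> measurable borel (count_space UNIV)" for b
    unfolding dyadic_index_def .
  from measurable_compose[OF comp this]
  have idx: "(\<lambda>x :: real ^ 'n. dyadic_index (a i) l k (x $ i)) \<in> measurable borel (count_space UNIV)" for i .
  have [measurable]: "Measurable.pred (borel \<Otimes>\<^sub>M borel)
      (\<lambda>z. dyadic_index (a i) l k (snd z $ i) = dyadic_index (a i) l k (fst z $ i))" for i
  proof -
    have "(\<lambda>z. dyadic_index (a i) l k (snd z $ i)) \<in> measurable (borel \<Otimes>\<^sub>M borel) (count_space UNIV)"
      "(\<lambda>z. dyadic_index (a i) l k (fst z $ i)) \<in> measurable (borel \<Otimes>\<^sub>M borel) (count_space UNIV)"
      by (rule measurable_compose[OF measurable_snd idx], rule measurable_compose[OF measurable_fst idx])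
    then show ?thesis by measurable
  qed
  have "Measurable.pred (borel \<Otimes>\<^sub>M borel)
      (\<lambda>z. snd z \<in> Q \<and> (\<forall>i. dyadic_index (a i) l k (snd z $ i) = dyadic_index (a i) l k (fst z $ i)))"
    by (intro pred_intros_logic pred_intros_finite) measurable
  then show ?thesis
    by (simp add: cell_def case_prod_beta')
qed

end

section \<open>Averages over dyadic cells\<close>

definition frac_kernel :: "real \<Rightarrow> real \<Rightarrow> (real ^ 'n \<Rightarrow> real) \<Rightarrow> real ^ 'n \<Rightarrow> real ^ 'n \<Rightarrow> ennreal" where
  "frac_kernel \<delta> p u x y = ennreal (\<bar>u x - u y\<bar> powr p / norm (x - y) powr (real CARD('n) + \<delta> * p))"

lemma frac_kernel_measurable [measurable]:
  fixes u :: "real ^ 'n \<Rightarrow> real"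
  assumes [measurable]: "u \<in> borel_measurable borel"
  shows "(\<lambda>(x, y). frac_kernel \<delta> p u x y) \<in> borel_measurable (borel \<Otimes>\<^sub>M borel)"
  unfolding frac_kernel_def by measurable

lemma powr_diff_le_frac_kernel:
  fixes x y :: "real ^ 'n"
  assumes "norm (x - y) \<le> \<rho>" and "0 \<le> real CARD('n) + \<delta> * p"
  shows "ennreal (\<bar>u x - u y\<bar> powr p) \<le> ennreal (\<rho> powr (real CARD('n) + \<delta> * p)) * frac_kernel \<delta> p u x y"
proof (cases "x = y")
  case False
  define s where "s = real CARD('n) + \<delta> * p"
  have "\<bar>u x - u y\<bar> powr p = norm (x - y) powr s * (\<bar>u x - u y\<bar> powr p / norm (x - y) powr s)"
    using False by simp
  also have "\<dots> \<le> \<rho> powr s * (\<bar>u x - u y\<bar> powr p / norm (x - y) powr s)"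
    using assms by (intro mult_right_mono powr_mono2) (auto simp: s_def)
  finally show ?thesis
    unfolding frac_kernel_def s_def by (simp add: ennreal_mult'[symmetric] ennreal_leI)
qed simp

context cube_grid
begin

definition side :: "nat \<Rightarrow> real" where
  "side k = l / 2 ^ k"

definition cell_average :: "(real ^ 'n \<Rightarrow> real) \<Rightarrow> nat \<Rightarrow> real ^ 'n \<Rightarrow> real" where
  "cell_average u k x = (LINT y:cell k x|lborel. u y) / side k powr real CARD('n)"

text \<open>
  The integration extends over all of \<open>Q\<close> also when \<open>x\<close> is restricted to a cell, so that one function
  serves all generations and is the inner integral of the seminorm.
\<close>

definition energy :: "real \<Rightarrow> real \<Rightarrow> (real ^ 'n \<Rightarrow> real) \<Rightarrow> real ^ 'n \<Rightarrow> ennreal" where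
  "energy \<delta> p u x = (\<integral>\<^sup>+y\<in>Q. frac_kernel \<delta> p u x y \<partial>lborel)"

lemma side_pos: "0 < side k"
  using l_pos by (simp add: side_def)

lemmas cell_side = cell_cube[folded side_def]

lemma cell_borel: "x \<in> Q \<Longrightarrow> cell k x \<in> sets borel"
  using cube_borel[OF cell_side] .

lemma energy_measurable [measurable]:
  assumes [measurable]: "u \<in> borel_measurable borel"
  shows "energy \<delta> p u \<in> borel_measurable borel"
  unfolding energy_def by measurable

lemma cell_indicator_measurable [measurable]:
  "(\<lambda>(x, y). indicator (cell k x) y :: ennreal) \<in> borel_measurable (borel \<Otimes>\<^sub>M borel)"
  unfolding indicator_def by measurable

lemma cell_average_diff_le:
  assumes [measurable]: "u \<in> borel_measurable borel" and int: "set_integrable lborel Q u"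
    and p: "1 \<le> p" and x: "x \<in> Q"
  shows "ennreal (\<bar>c - cell_average u k x\<bar> powr p)
    \<le> ennreal (1 / side k powr real CARD('n)) * (\<integral>\<^sup>+y\<in>cell k x. ennreal (\<bar>c - u y\<bar> powr p) \<partial>lborel)"
  unfolding cell_average_def
proof (rule powr_dist_average_le)
  show "set_integrable lborel (cell k x) u"
    using int by (rule set_integrable_subset) (use cell_subset cell_borel[OF x] in auto)
qed (use cell_borel[OF x] cube_emeasure[OF cell_side[OF x]] side_pos[of k] p in auto)

text \<open>
  Jensen bounds the left side by the mean of \<open>\<bar>u y - u z\<bar>\<^sup>p\<close> over \<open>y\<close> in the child and \<open>z\<close> in the parent
  cell. Enlarging the child to its parent costs \<open>2\<^sup>n\<close>, and the fractional Poincare inequality on the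
  parent supplies the factor \<open>1 - \<delta>\<close>.
\<close>

lemma cell_average_step:
  assumes [measurable]: "u \<in> borel_measurable borel" and int: "set_integrable lborel Q u"
    and p: "1 \<le> p" and \<delta>: "0 < \<delta>" "\<delta> < 1" and x: "x \<in> Q"
  shows "ennreal (\<bar>cell_average u (Suc k) x - cell_average u k x\<bar> powr p)
    \<le> ennreal (2 * 2 ^ CARD('n) * sqrt (real CARD('n)) powr (real CARD('n) + \<delta> * p) * (p * (1 - \<delta>))
        * side k powr (\<delta> * p - real CARD('n)))
      * (\<integral>\<^sup>+y\<in>cell k x. energy \<delta> p u y \<partial>lborel)"
proof -
  let ?n = "real CARD('n)"
  define S where "S = side k"
  define R where "R = cell k x"
  have S: "0 < S" "side (Suc k) = S / 2"
    using side_pos[of k] by (auto simp: S_def side_def)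
  have [measurable]: "R \<in> sets borel"
    unfolding R_def using x by (rule cell_borel)
  have R_cube: "cube_of_side R S"
    unfolding R_def S_def using x by (rule cell_side)
  define D where "D y z = ennreal (\<bar>u y - u z\<bar> powr p)" for y z
  have [measurable]: "(\<lambda>(y, z). D y z) \<in> borel_measurable (borel \<Otimes>\<^sub>M borel)"
    unfolding D_def by measurable
  have inner: "ennreal (\<bar>cell_average u (Suc k) x - u z\<bar> powr p)
      \<le> ennreal (1 / (S / 2) powr ?n) * (\<integral>\<^sup>+y\<in>R. D z y \<partial>lborel)" for z
  proof -
    have "ennreal (\<bar>u z - cell_average u (Suc k) x\<bar> powr p)
        \<le> ennreal (1 / (S / 2) powr ?n) * (\<integral>\<^sup>+y\<in>cell (Suc k) x. D z y \<partial>lborel)"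
      using cell_average_diff_le[OF assms(1) int p x, of "u z" "Suc k"] by (simp add: S D_def)
    also have "\<dots> \<le> ennreal (1 / (S / 2) powr ?n) * (\<integral>\<^sup>+y\<in>R. D z y \<partial>lborel)"
      using cell_Suc_subset[of k x]
      by (intro mult_left_mono nn_integral_mono) (auto simp: R_def indicator_def)
    finally show ?thesis by (simp add: abs_minus_commute)
  qed
  have "ennreal (\<bar>cell_average u (Suc k) x - cell_average u k x\<bar> powr p)
      \<le> ennreal (1 / S powr ?n) * (\<integral>\<^sup>+z\<in>R. ennreal (\<bar>cell_average u (Suc k) x - u z\<bar> powr p) \<partial>lborel)"
    unfolding S_def R_def by (rule cell_average_diff_le[OF assms(1) int p x])
  also have "\<dots> \<le> ennreal (1 / S powr ?n) * (\<integral>\<^sup>+z\<in>R. ennreal (1 / (S / 2) powr ?n) * (\<integral>\<^sup>+y\<in>R. D z y \<partial>lborel) \<partial>lborel)"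
    by (intro mult_left_mono nn_integral_mono mult_right_mono inner) auto
  also have "\<dots> = ennreal (1 / S powr ?n) * (ennreal (1 / (S / 2) powr ?n) * (\<integral>\<^sup>+z\<in>R. (\<integral>\<^sup>+y\<in>R. D z y \<partial>lborel) \<partial>lborel))"
    by (simp add: nn_integral_cmult mult.assoc)
  also have "\<dots> \<le> ennreal (1 / S powr ?n) * (ennreal (1 / (S / 2) powr ?n) *
      (ennreal (2 * (sqrt ?n * S) powr (?n + \<delta> * p) * (p * (1 - \<delta>))) *
        (\<integral>\<^sup>+z\<in>R. (\<integral>\<^sup>+y\<in>R. frac_kernel \<delta> p u z y \<partial>lborel) \<partial>lborel)))"
    using fractional_poincare_convex[OF assms(1) _ cube_convex[OF R_cube] p \<delta> _ cube_diameter[OF R_cube]] S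
    by (intro mult_left_mono) (auto simp: D_def frac_kernel_def)
  also have "\<dots> \<le> ennreal (1 / S powr ?n) * (ennreal (1 / (S / 2) powr ?n) *
      (ennreal (2 * (sqrt ?n * S) powr (?n + \<delta> * p) * (p * (1 - \<delta>))) *
        (\<integral>\<^sup>+z\<in>R. energy \<delta> p u z \<partial>lborel)))"
    unfolding energy_def using cell_subset[of k x]
    by (intro mult_left_mono nn_integral_mono mult_right_mono) (auto simp: R_def indicator_def)
  also have "\<dots> = ennreal (1 / S powr ?n * (1 / (S / 2) powr ?n) * (2 * (sqrt ?n * S) powr (?n + \<delta> * p) * (p * (1 - \<delta>))))
      * (\<integral>\<^sup>+z\<in>R. energy \<delta> p u z \<partial>lborel)"
  proof -
    have "ennreal b * (ennreal c * (ennreal d * t)) = ennreal (b * c * d) * t" if "0 \<le> b" "0 \<le> c" "0 \<le> d" for b c d t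
      using that by (simp add: ennreal_mult mult.assoc)
    from this[of "1 / S powr ?n" "1 / (S / 2) powr ?n" "2 * (sqrt ?n * S) powr (?n + \<delta> * p) * (p * (1 - \<delta>))"]
    show ?thesis using p \<delta> by (simp add: mult.assoc)
  qed
  also have "1 / S powr ?n * (1 / (S / 2) powr ?n) * (2 * (sqrt ?n * S) powr (?n + \<delta> * p) * (p * (1 - \<delta>)))
      = 2 * 2 ^ CARD('n) * sqrt ?n powr (?n + \<delta> * p) * (p * (1 - \<delta>)) * S powr (\<delta> * p - ?n)"
    using S by (simp add: powr_divide powr_mult powr_diff powr_add powr_realpow field_simps)
  finally show ?thesis
    unfolding S_def R_def .
qed

text \<open>
  On the cell one has \<open>\<bar>u x - u y\<bar>\<^sup>p \<le> (\<surd>n l\<^sub>k)\<^bsup>n + \<delta>p\<^esup> K(x,y)\<close>. For fixed \<open>x\<close> this crude bound, without the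
  factor \<open>1 - \<delta>\<close>, already shows that the averages converge where the energy is finite.
\<close>

lemma cell_average_dist:
  assumes [measurable]: "u \<in> borel_measurable borel" and int: "set_integrable lborel Q u"
    and p: "1 \<le> p" and \<delta>: "0 < \<delta>" and x: "x \<in> Q"
  shows "ennreal (\<bar>u x - cell_average u k x\<bar> powr p)
    \<le> ennreal (sqrt (real CARD('n)) powr (real CARD('n) + \<delta> * p) * side k powr (\<delta> * p)) * energy \<delta> p u x"
proof -
  let ?n = "real CARD('n)"
  define S where "S = side k"
  have S: "0 < S"
    using side_pos[of k] by (auto simp: S_def)
  have [measurable]: "cell k x \<in> sets borel"
    using x by (rule cell_borel)
  have "ennreal (\<bar>u x - cell_average u k x\<bar> powr p)
      \<le> ennreal (1 / S powr ?n) * (\<integral>\<^sup>+y\<in>cell k x. ennreal (\<bar>u x - u y\<bar> powr p) \<partial>lborel)"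
    unfolding S_def by (rule cell_average_diff_le[OF assms(1) int p x])
  also have "\<dots> \<le> ennreal (1 / S powr ?n) * (\<integral>\<^sup>+y\<in>Q. ennreal ((sqrt ?n * S) powr (?n + \<delta> * p)) * frac_kernel \<delta> p u x y \<partial>lborel)"
  proof (intro mult_left_mono nn_integral_mono)
    fix y
    show "ennreal (\<bar>u x - u y\<bar> powr p) * indicator (cell k x) y
        \<le> ennreal ((sqrt ?n * S) powr (?n + \<delta> * p)) * frac_kernel \<delta> p u x y * indicator Q y"
    proof (cases "y \<in> cell k x")
      case True
      then have "norm (x - y) \<le> sqrt ?n * S" "y \<in> Q"
        using cube_diameter[OF cell_side[OF x] self_in_cell[OF x]] cell_subset[of k x] by (auto simp: S_def)
      then show ?thesis
        using True powr_diff_le_frac_kernel[of x y "sqrt ?n * S" \<delta> p u] p \<delta> by simp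
    qed simp
  qed simp
  also have "\<dots> = ennreal (1 / S powr ?n) * (ennreal ((sqrt ?n * S) powr (?n + \<delta> * p)) * energy \<delta> p u x)"
    by (simp add: energy_def nn_integral_cmult mult.assoc)
  also have "\<dots> = ennreal (1 / S powr ?n * (sqrt ?n * S) powr (?n + \<delta> * p)) * energy \<delta> p u x"
    by (subst ennreal_mult) (auto simp: mult.assoc)
  also have "1 / S powr ?n * (sqrt ?n * S) powr (?n + \<delta> * p) = sqrt ?n powr (?n + \<delta> * p) * S powr (\<delta> * p)"
    using S by (simp add: powr_mult powr_add)
  finally show ?thesis
    unfolding S_def .
qed

lemma cell_average_tendsto:
  assumes u: "u \<in> borel_measurable borel" and int: "set_integrable lborel Q u"
    and p: "1 \<le> p" and \<delta>: "0 < \<delta>" and x: "x \<in> Q" and fin: "energy \<delta> p u x < \<infinity>"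
  shows "(\<lambda>k. cell_average u k x) \<longlonglongrightarrow> u x"
proof -
  let ?n = "real CARD('n)"
  define c where "c = sqrt ?n powr (?n + \<delta> * p) * enn2real (energy \<delta> p u x)"
  have bound: "\<bar>u x - cell_average u k x\<bar> \<le> (c * side k powr (\<delta> * p)) powr (1 / p)" for k
  proof -
    have "ennreal (\<bar>u x - cell_average u k x\<bar> powr p) \<le> ennreal (c * side k powr (\<delta> * p))"
      using cell_average_dist[OF u int p \<delta> x, of k] fin
      by (cases "energy \<delta> p u x") (auto simp: c_def ennreal_mult'[symmetric] mult.commute mult.left_commute)
    then have "\<bar>u x - cell_average u k x\<bar> powr p \<le> c * side k powr (\<delta> * p)"
      by (subst (asm) ennreal_le_iff) (auto simp: c_def)
    then have "(\<bar>u x - cell_average u k x\<bar> powr p) powr (1 / p) \<le> (c * side k powr (\<delta> * p)) powr (1 / p)"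
      using p by (intro powr_mono2) auto
    then show ?thesis
      using p by (simp add: powr_powr)
  qed
  have "side \<longlonglongrightarrow> 0"
    unfolding side_def by real_asymp
  then have "(\<lambda>k. side k powr (\<delta> * p)) \<longlonglongrightarrow> 0 powr (\<delta> * p)"
    by (rule tendsto_powr2) (use \<delta> p side_pos in \<open>auto intro!: always_eventually less_imp_le\<close>)
  then have "(\<lambda>k. c * side k powr (\<delta> * p)) \<longlonglongrightarrow> c * 0"
    by (intro tendsto_mult tendsto_const) (use \<delta> p in auto)
  then have "(\<lambda>k. (c * side k powr (\<delta> * p)) powr (1 / p)) \<longlonglongrightarrow> 0 powr (1 / p)"
    by (intro tendsto_powr2 tendsto_const) (use p in \<open>auto simp: c_def\<close>)
  then have "(\<lambda>k. (c * side k powr (\<delta> * p)) powr (1 / p)) \<longlonglongrightarrow> 0"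
    by simp
  then have "(\<lambda>k. u x - cell_average u k x) \<longlonglongrightarrow> 0"
    by (rule Lim_null_comparison[rotated]) (simp add: bound)
  from tendsto_diff[OF tendsto_const[of "u x"] this] show ?thesis
    by simp
qed

text \<open>
  Both sides integrate over the pairs of points of \<open>Q\<close> that share a cell, a symmetric relation.
\<close>

lemma fubini_cell:
  assumes [measurable]: "f \<in> borel_measurable borel" "g \<in> borel_measurable borel"
  shows "(\<integral>\<^sup>+x\<in>Q. (\<integral>\<^sup>+y\<in>cell k x. f y \<partial>lborel) * g x \<partial>lborel) = (\<integral>\<^sup>+y\<in>Q. f y * (\<integral>\<^sup>+x\<in>cell k y. g x \<partial>lborel) \<partial>lborel)"
proof -
  let ?H = "\<lambda>x y. indicator Q x * indicator (cell k x) y * f y * g x"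
  have [measurable]: "(\<lambda>y. indicator (cell k x) y :: ennreal) \<in> borel_measurable borel" for x
    by measurable
  have "(\<integral>\<^sup>+x\<in>Q. (\<integral>\<^sup>+y\<in>cell k x. f y \<partial>lborel) * g x \<partial>lborel) = (\<integral>\<^sup>+x. \<integral>\<^sup>+y. ?H x y \<partial>lborel \<partial>lborel)"
  proof (intro nn_integral_cong)
    fix x
    have "(\<integral>\<^sup>+y\<in>cell k x. f y \<partial>lborel) * (g x * indicator Q x)
        = (\<integral>\<^sup>+y. f y * indicator (cell k x) y * (g x * indicator Q x) \<partial>lborel)"
      by (rule nn_integral_multc[symmetric]) measurable
    also have "\<dots> = (\<integral>\<^sup>+y. ?H x y \<partial>lborel)"
      by (intro nn_integral_cong) (simp add: mult_ac)
    finally show "(\<integral>\<^sup>+y\<in>cell k x. f y \<partial>lborel) * g x * indicator Q x = (\<integral>\<^sup>+y. ?H x y \<partial>lborel)"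
      by (simp add: mult.assoc)
  qed
  also have "\<dots> = (\<integral>\<^sup>+y. \<integral>\<^sup>+x. ?H x y \<partial>lborel \<partial>lborel)"
    by (rule lborel_pair.Fubini') measurable
  also have "\<dots> = (\<integral>\<^sup>+y\<in>Q. f y * (\<integral>\<^sup>+x\<in>cell k y. g x \<partial>lborel) \<partial>lborel)"
  proof (intro nn_integral_cong)
    fix y
    have "(\<integral>\<^sup>+x. ?H x y \<partial>lborel) = (\<integral>\<^sup>+x. f y * indicator Q y * (g x * indicator (cell k y) x) \<partial>lborel)"
      using cell_sym[of _ y k] cell_sym[of y _ k] by (intro nn_integral_cong) (auto simp: indicator_def)
    also have "\<dots> = f y * indicator Q y * (\<integral>\<^sup>+x\<in>cell k y. g x \<partial>lborel)"
      by (rule nn_integral_cmult) measurable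
    finally show "(\<integral>\<^sup>+x. ?H x y \<partial>lborel) = f y * (\<integral>\<^sup>+x\<in>cell k y. g x \<partial>lborel) * indicator Q y"
      by (simp add: mult_ac)
  qed
  finally show ?thesis .
qed

text \<open>
  The hypothesis on \<open>T\<close> says that at every generation the weight averaged over cells, scaled by
  \<open>l\<^sub>k\<^bsup>(\<delta>-\<epsilon>)p\<^esup>\<close>, has integral at most \<open>T\<close> against the energy. Phrasing it with averages instead of
  the maximal function keeps every integrand measurable.
\<close>

lemma weighted_oscillation_le:
  assumes [measurable]: "u \<in> borel_measurable borel" "w \<in> borel_measurable borel"
    and int: "set_integrable lborel Q u"
    and p: "1 \<le> p" and \<delta>: "0 < \<delta>" "\<delta> < 1" and \<epsilon>: "0 < \<epsilon>"
    and T: "\<And>k. (\<integral>\<^sup>+y\<in>Q. energy \<delta> p u y * (ennreal (side k powr ((\<delta> - \<epsilon>) * p - real CARD('n)))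
        * (\<integral>\<^sup>+x\<in>cell k y. w x \<partial>lborel)) \<partial>lborel) \<le> T"
  shows "(\<integral>\<^sup>+x\<in>Q. ennreal (\<bar>u x - (LINT y:Q|lborel. u y) / l powr real CARD('n)\<bar> powr p) * w x \<partial>lborel)
    \<le> ennreal ((1 / (1 - 2 powr - \<epsilon>)) powr p * (2 * 2 ^ CARD('n) * sqrt (real CARD('n)) powr (real CARD('n) + \<delta> * p) * (p * (1 - \<delta>)))
        * l powr (\<epsilon> * p)) * T"
proof -
  let ?n = "real CARD('n)"
  define m where "m = (LINT y:Q|lborel. u y) / l powr ?n"
  define C where "C = 2 * 2 ^ CARD('n) * sqrt ?n powr (?n + \<delta> * p) * (p * (1 - \<delta>))"
  define \<theta> where "\<theta> = 2 powr - \<epsilon>"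
  define L where "L = 1 / (1 - \<theta>)"
  define s where "s = (\<delta> - \<epsilon>) * p - ?n"
  define b where "b k x = ennreal (\<theta> ^ k * (C * l powr (\<epsilon> * p)) * side k powr s)
      * (\<integral>\<^sup>+y\<in>cell k x. energy \<delta> p u y \<partial>lborel)" for k x
  have \<theta>: "0 < \<theta>" "\<theta> < 1"
    using \<epsilon> by (auto simp: \<theta>_def powr_less_one)
  have L: "0 < L"
    using \<theta> by (simp add: L_def)
  have C: "0 \<le> C"
    using p \<delta> by (simp add: C_def)
  have [measurable]: "b k \<in> borel_measurable borel" for k
    unfolding b_def by measurable
  have avg0: "cell_average u 0 x = m" if "x \<in> Q" for x
    using that by (simp add: cell_average_def cell_0 side_def m_def)
  \<comment> \<open>The limit of the telescoped bound for \<open>A\<^sub>N - A\<^sub>0\<close>, at points where the averages converge.\<close>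
  have pointwise: "ennreal (\<bar>u x - m\<bar> powr p) \<le> ennreal (L powr (p - 1)) * (\<Sum>k. b k x)"
    if x: "x \<in> Q" and fin: "energy \<delta> p u x < \<infinity>" for x
  proof -
    define d where "d k = \<bar>cell_average u (Suc k) x - cell_average u k x\<bar>" for k
    have step: "ennreal (\<theta> ^ k * (d k / \<theta> ^ k) powr p) \<le> b k x" for k
    proof -
      \<comment> \<open>The factor \<open>\<theta>\<^sup>k\<close> is \<open>(l\<^sub>k / l)\<^sup>\<epsilon>\<close>, so it turns part of the gain \<open>l\<^sub>k\<^bsup>\<delta>p\<^esup>\<close> into \<open>l\<^bsup>\<epsilon>p\<^esup>\<close>.\<close>
      have scale: "side k powr (\<epsilon> * p) = l powr (\<epsilon> * p) * (\<theta> ^ k) powr p"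
      proof -
        have "side k powr (\<epsilon> * p) = l powr (\<epsilon> * p) * 2 powr (- (real k * (\<epsilon> * p)))"
          using l_pos by (simp add: side_def powr_divide powr_minus_divide powr_powr flip: powr_realpow)
        also have "2 powr (- (real k * (\<epsilon> * p))) = (\<theta> ^ k) powr p"
          by (simp add: \<theta>_def powr_powr mult_ac flip: powr_realpow)
        finally show ?thesis .
      qed
      have "ennreal (\<theta> ^ k * (d k / \<theta> ^ k) powr p) = ennreal (\<theta> ^ k / (\<theta> ^ k) powr p) * ennreal (d k powr p)"
        using \<theta> by (simp add: powr_divide d_def ennreal_mult'[symmetric])
      also have "\<dots> \<le> ennreal (\<theta> ^ k / (\<theta> ^ k) powr p) * (ennreal (C * side k powr (\<delta> * p - ?n))
          * (\<integral>\<^sup>+y\<in>cell k x. energy \<delta> p u y \<partial>lborel))"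
        unfolding d_def C_def by (intro mult_left_mono cell_average_step[OF assms(1) int p \<delta> x]) simp
      also have "\<dots> = ennreal (\<theta> ^ k / (\<theta> ^ k) powr p * (C * side k powr (\<delta> * p - ?n)))
          * (\<integral>\<^sup>+y\<in>cell k x. energy \<delta> p u y \<partial>lborel)"
        using \<theta> C by (subst ennreal_mult) (auto simp: mult.assoc)
      also have "\<theta> ^ k / (\<theta> ^ k) powr p * (C * side k powr (\<delta> * p - ?n)) = \<theta> ^ k * (C * l powr (\<epsilon> * p)) * side k powr s"
      proof -
        have "side k powr (\<delta> * p - ?n) = side k powr s * side k powr (\<epsilon> * p)"
          using side_pos[of k] by (simp add: s_def powr_add[symmetric] algebra_simps)
        also have "\<dots> = side k powr s * (l powr (\<epsilon> * p) * (\<theta> ^ k) powr p)"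
          by (simp only: scale)
        finally show ?thesis
          using \<theta> by simp
      qed
      finally show ?thesis unfolding b_def .
    qed
    have lim: "(\<lambda>N. ennreal (\<bar>cell_average u N x - m\<bar> powr p)) \<longlonglongrightarrow> ennreal (\<bar>u x - m\<bar> powr p)"
      using cell_average_tendsto[OF assms(1) int p \<delta>(1) x fin] p
      by (intro tendsto_ennrealI tendsto_powr2 tendsto_rabs tendsto_diff tendsto_const) auto
    have bound: "ennreal (\<bar>cell_average u N x - m\<bar> powr p) \<le> ennreal (L powr (p - 1)) * (\<Sum>k. b k x)" for N
    proof -
      have "ennreal (\<bar>cell_average u N x - m\<bar> powr p)
          \<le> ennreal (L powr (p - 1) * (\<Sum>k<N. \<theta> ^ k * (d k / \<theta> ^ k) powr p))"
        using telescope_powr_le[OF \<theta> p, of "\<lambda>k. cell_average u k x" N] avg0[OF x]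
        by (intro ennreal_leI) (simp add: d_def L_def)
      also have "\<dots> = ennreal (L powr (p - 1)) * (\<Sum>k<N. ennreal (\<theta> ^ k * (d k / \<theta> ^ k) powr p))"
        using \<theta> by (subst sum_ennreal) (auto intro!: ennreal_mult')
      also have "\<dots> \<le> ennreal (L powr (p - 1)) * (\<Sum>k<N. b k x)"
        by (intro mult_left_mono sum_mono step) simp
      also have "\<dots> \<le> ennreal (L powr (p - 1)) * (\<Sum>k. b k x)"
        by (intro mult_left_mono sum_le_suminf) auto
      finally show ?thesis .
    qed
    show ?thesis
      by (rule LIMSEQ_le_const2[OF lim]) (use bound in blast)
  qed
  \<comment> \<open>Fubini moves the average over the cell from the energy to the weight.\<close>
  have level: "(\<integral>\<^sup>+x\<in>Q. b k x * w x \<partial>lborel) \<le> ennreal (\<theta> ^ k * (C * l powr (\<epsilon> * p))) * T" for k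
  proof -
    define F where "F x = (\<integral>\<^sup>+y\<in>cell k x. energy \<delta> p u y \<partial>lborel) * w x * indicator Q x" for x
    have [measurable]: "F \<in> borel_measurable borel"
      unfolding F_def by measurable
    let ?c = "ennreal (\<theta> ^ k * (C * l powr (\<epsilon> * p)))" and ?s = "ennreal (side k powr s)"
    have "(\<integral>\<^sup>+x\<in>Q. b k x * w x \<partial>lborel) = (\<integral>\<^sup>+x. ?c * (?s * F x) \<partial>lborel)"
      using \<theta> C by (intro nn_integral_cong) (simp add: b_def F_def ennreal_mult mult.assoc)
    also have "\<dots> = ?c * (?s * (\<integral>\<^sup>+x\<in>Q. (\<integral>\<^sup>+y\<in>cell k x. energy \<delta> p u y \<partial>lborel) * w x \<partial>lborel))"
      by (simp add: nn_integral_cmult flip: F_def)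
    also have "\<dots> = ?c * (?s * (\<integral>\<^sup>+y\<in>Q. energy \<delta> p u y * (\<integral>\<^sup>+x\<in>cell k y. w x \<partial>lborel) \<partial>lborel))"
      by (subst fubini_cell) measurable
    also have "?s * (\<integral>\<^sup>+y\<in>Q. energy \<delta> p u y * (\<integral>\<^sup>+x\<in>cell k y. w x \<partial>lborel) \<partial>lborel)
        = (\<integral>\<^sup>+y. ?s * (energy \<delta> p u y * (\<integral>\<^sup>+x\<in>cell k y. w x \<partial>lborel) * indicator Q y) \<partial>lborel)"
      by (rule nn_integral_cmult[symmetric]) measurable
    also have "\<dots> = (\<integral>\<^sup>+y\<in>Q. energy \<delta> p u y * (?s * (\<integral>\<^sup>+x\<in>cell k y. w x \<partial>lborel)) \<partial>lborel)"
      by (intro nn_integral_cong) (simp add: mult_ac)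
    also have "?c * \<dots> \<le> ?c * T"
      unfolding s_def by (intro mult_left_mono T) simp
    finally show ?thesis .
  qed
  have main: "(\<integral>\<^sup>+x\<in>Q. ennreal (\<bar>u x - m\<bar> powr p) * w x \<partial>lborel) \<le> ennreal (L powr p * C * l powr (\<epsilon> * p)) * T"
    if fin: "AE x in lborel. x \<in> Q \<longrightarrow> energy \<delta> p u x < \<infinity>"
  proof -
    have "(\<integral>\<^sup>+x\<in>Q. ennreal (\<bar>u x - m\<bar> powr p) * w x \<partial>lborel)
        \<le> (\<integral>\<^sup>+x\<in>Q. ennreal (L powr (p - 1)) * (\<Sum>k. b k x) * w x \<partial>lborel)"
      using fin by (intro nn_integral_mono_AE) (auto elim!: eventually_mono simp: indicator_def intro!: mult_right_mono pointwise)
    also have "\<dots> = (\<integral>\<^sup>+x. ennreal (L powr (p - 1)) * (\<Sum>k. b k x * w x * indicator Q x) \<partial>lborel)"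
      by (simp add: mult.assoc)
    also have "\<dots> = ennreal (L powr (p - 1)) * (\<Sum>k. \<integral>\<^sup>+x\<in>Q. b k x * w x \<partial>lborel)"
      by (subst nn_integral_cmult) (measurable, subst nn_integral_suminf, measurable)
    also have "\<dots> \<le> ennreal (L powr (p - 1)) * (\<Sum>k. ennreal (\<theta> ^ k * (C * l powr (\<epsilon> * p))) * T)"
      by (intro mult_left_mono suminf_le level) auto
    also have "(\<Sum>k. ennreal (\<theta> ^ k * (C * l powr (\<epsilon> * p))) * T) = ennreal (L * (C * l powr (\<epsilon> * p))) * T"
    proof -
      have "(\<lambda>k. \<theta> ^ k * (C * l powr (\<epsilon> * p))) sums (L * (C * l powr (\<epsilon> * p)))"
        unfolding L_def using \<theta> by (intro sums_mult2 geometric_sums) simp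
      then have "(\<Sum>k. ennreal (\<theta> ^ k * (C * l powr (\<epsilon> * p)))) = ennreal (L * (C * l powr (\<epsilon> * p)))"
        using \<theta> C by (intro suminf_ennreal_eq) auto
      then show ?thesis by simp
    qed
    also have "ennreal (L powr (p - 1)) * (ennreal (L * (C * l powr (\<epsilon> * p))) * T) = ennreal (L powr p * C * l powr (\<epsilon> * p)) * T"
    proof -
      have "L powr p = L powr (p - 1) * L"
        using L by (simp add: powr_diff)
      then show ?thesis
        using L C by (simp add: mult.assoc[symmetric] ennreal_mult[symmetric])
    qed
    finally show ?thesis .
  qed
  have "(\<integral>\<^sup>+x\<in>Q. ennreal (\<bar>u x - m\<bar> powr p) * w x \<partial>lborel) \<le> ennreal (L powr p * C * l powr (\<epsilon> * p)) * T"
  proof (cases "T = \<infinity> \<or> (\<integral>\<^sup>+x\<in>Q. w x \<partial>lborel) = 0")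
    case False
    \<comment> \<open>The generation \<open>k = 0\<close>, where the cell is \<open>Q\<close>, shows for finite \<open>T\<close> that the energy is integrable unless
      \<open>w\<close> vanishes almost everywhere on \<open>Q\<close>.\<close>
    define c where "c = ennreal (side 0 powr s) * (\<integral>\<^sup>+x\<in>Q. w x \<partial>lborel)"
    have "c \<noteq> 0"
      using False side_pos[of 0] by (simp add: c_def)
    have "(\<integral>\<^sup>+y. energy \<delta> p u y * indicator Q y * c \<partial>lborel)
        = (\<integral>\<^sup>+y\<in>Q. energy \<delta> p u y * (ennreal (side 0 powr s) * (\<integral>\<^sup>+x\<in>cell 0 y. w x \<partial>lborel)) \<partial>lborel)"
      by (intro nn_integral_cong) (auto simp: c_def cell_0 indicator_def)
    also have "\<dots> \<le> T"
      unfolding s_def by (rule T)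
    finally have "(\<integral>\<^sup>+y\<in>Q. energy \<delta> p u y \<partial>lborel) * c \<le> T"
      by (simp add: nn_integral_multc)
    then have "(\<integral>\<^sup>+y\<in>Q. energy \<delta> p u y \<partial>lborel) \<noteq> \<infinity>"
      using \<open>c \<noteq> 0\<close> False by (auto simp: ennreal_top_mult top_unique)
    then have "AE x in lborel. energy \<delta> p u x * indicator Q x \<noteq> \<infinity>"
      by (intro nn_integral_PInf_AE) auto
    then show ?thesis
      by (intro main) (auto elim!: eventually_mono simp: less_top)
  next
    case True
    then show ?thesis
    proof
      assume "(\<integral>\<^sup>+x\<in>Q. w x \<partial>lborel) = 0"
      then have "AE x in lborel. w x * indicator Q x = 0"
        by (subst (asm) nn_integral_0_iff_AE) auto
      then have "AE x in lborel. ennreal (\<bar>u x - m\<bar> powr p) * w x * indicator Q x = 0"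
        by eventually_elim (auto simp: indicator_def)
      then have "(\<integral>\<^sup>+x\<in>Q. ennreal (\<bar>u x - m\<bar> powr p) * w x \<partial>lborel) = 0"
        by (subst nn_integral_0_iff_AE) auto
      then show ?thesis by simp
    next
      assume "T = \<infinity>"
      then have "ennreal c * T = \<infinity>" if "0 < c" for c
        using that by (simp add: ennreal_mult_top)
      moreover have "0 < L powr p * C * l powr (\<epsilon> * p)"
        using L l_pos p \<delta> by (simp add: C_def)
      ultimately have "ennreal (L powr p * C * l powr (\<epsilon> * p)) * T = \<infinity>"
        by blast
      then show ?thesis by (simp only: infinity_ennreal_def top_greatest)
    qed
  qed
  then show ?thesis
    unfolding m_def L_def C_def \<theta>_def .
qed

end

section \<open>The size of the constant\<close>

lemma epowr_mono: "0 < r \<Longrightarrow> s \<le> t \<Longrightarrow> epowr s r \<le> epowr t r"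
  by (cases s; cases t) (auto simp: epowr_def top_unique intro!: ennreal_leI powr_mono2)

lemma epowr_mult:
  assumes "0 < r"
  shows "epowr (s * t) r = epowr s r * epowr t r"
proof (cases s; cases t)
  fix a b assume "s = ennreal a" "0 \<le> a" "t = ennreal b" "0 \<le> b"
  then show ?thesis
    by (simp add: epowr_def ennreal_mult[symmetric] powr_mult)
qed (use assms in \<open>auto simp: epowr_def ennreal_mult_top ennreal_top_mult\<close>)

lemma epowr_ennreal: "0 \<le> c \<Longrightarrow> epowr (ennreal c) r = ennreal (c powr r)"
  by (simp add: epowr_def)

text \<open>
  A factor \<open>2\<close> comes from \<open>1 / (1 - 2\<^bsup>-\<epsilon>\<^esup>) \<le> 2 / \<epsilon>\<close>, the factor \<open>2 \<cdot> 2\<^sup>n \<surd>n\<^bsup>n+1\<^esup>\<close> from a step between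
  generations of cells, and \<open>e\<close> from the bound \<open>p\<^bsup>1/p\<^esup> \<le> e\<close>.
\<close>

definition bbm_constant :: "nat \<Rightarrow> real" where
  "bbm_constant n = 4 * 2 ^ n * exp 1 * sqrt (real n) ^ (n + 1)"

text \<open>
  On \<open>[0, 1]\<close> the convex function \<open>2\<^bsup>-x\<^esup>\<close> lies below its chord \<open>1 - x / 2\<close>.
\<close>

lemma half_le_one_minus_two_powr:
  fixes x :: real
  assumes "0 \<le> x" "x \<le> 1"
  shows "x / 2 \<le> 1 - 2 powr - x"
proof -
  have "exp ((1 - x) *\<^sub>R 0 + x *\<^sub>R (- ln 2)) \<le> (1 - x) * exp 0 + x * exp (- ln (2::real))"
    using assms by (intro convex_onD[OF exp_convex]) auto
  then show ?thesis
    by (simp add: powr_def exp_minus)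
qed

text \<open>
  The \<open>p\<close>-th root of the left side must be bounded with a constant free of \<open>p\<close>, \<open>\<delta>\<close> and \<open>\<epsilon>\<close>. Apart
  from \<open>(2 / \<epsilon>)\<^sup>p\<close>, \<open>1 - \<delta>\<close> and \<open>l\<^bsup>\<epsilon>p\<^esup>\<close>, each factor is bounded by the \<open>p\<close>-th power of a constant: \<open>2 \<cdot> 2\<^sup>n \<ge> 1\<close> may be raised to the power \<open>p\<close>,
  \<open>n + \<delta>p \<le> (n + 1) p\<close>, and \<open>p \<le> e\<^sup>p\<close>.
\<close>

lemma bbm_constant_bound:
  fixes p \<delta> \<epsilon> l :: real
  assumes n: "1 \<le> n" and p: "1 \<le> p" and \<delta>: "0 < \<delta>" "\<delta> < 1" and \<epsilon>: "0 < \<epsilon>" "\<epsilon> \<le> 1" and l: "0 < l"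
  shows "(1 / (1 - 2 powr - \<epsilon>)) powr p * (2 * 2 ^ n * sqrt (real n) powr (real n + \<delta> * p) * (p * (1 - \<delta>))) * l powr (\<epsilon> * p)
    \<le> (bbm_constant n * ((1 - \<delta>) powr (1 / p) / \<epsilon>) * l powr \<epsilon>) powr p"
proof -
  have "1 / (1 - 2 powr - \<epsilon>) \<le> 1 / (\<epsilon> / 2)"
    using half_le_one_minus_two_powr[of \<epsilon>] \<epsilon> by (intro divide_left_mono) (auto simp: powr_less_one)
  then have 1: "(1 / (1 - 2 powr - \<epsilon>)) powr p \<le> (2 / \<epsilon>) powr p"
    using \<epsilon> p by (intro powr_mono2) (auto simp: powr_less_one less_imp_le)
  have "(1::real) \<le> 2 ^ n"
    by simp
  then have "(1::real) \<le> 2 * 2 ^ n"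
    by linarith
  then have 2: "2 * 2 ^ n \<le> (2 * 2 ^ n :: real) powr p"
    using p powr_mono[of 1 p "2 * 2 ^ n :: real"] by simp
  have "real n + \<delta> * p \<le> real n * p + 1 * p"
    using p \<delta> by (intro add_mono mult_right_mono) (auto simp: mult_le_cancel_left1)
  then have "sqrt (real n) powr (real n + \<delta> * p) \<le> sqrt (real n) powr (real (n + 1) * p)"
    using n by (intro powr_mono) (auto simp: algebra_simps)
  also have "\<dots> = (sqrt (real n) ^ (n + 1)) powr p"
    using n by (subst powr_powr[symmetric]) (simp only: powr_realpow real_sqrt_gt_0_iff of_nat_0_less_iff)
  finally have 3: "sqrt (real n) powr (real n + \<delta> * p) \<le> (sqrt (real n) ^ (n + 1)) powr p" .
  have 4: "p \<le> exp 1 powr p"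
  proof -
    have "p \<le> exp p"
      using exp_ge_add_one_self[of p] by linarith
    then show ?thesis by (simp add: powr_def)
  qed
  have "(1 / (1 - 2 powr - \<epsilon>)) powr p * (2 * 2 ^ n * sqrt (real n) powr (real n + \<delta> * p) * (p * (1 - \<delta>))) * l powr (\<epsilon> * p)
    \<le> (2 / \<epsilon>) powr p * ((2 * 2 ^ n) powr p * (sqrt (real n) ^ (n + 1)) powr p * (exp 1 powr p * (1 - \<delta>))) * l powr (\<epsilon> * p)"
    using 1 2 3 4 p \<delta> by (intro mult_mono order_refl) auto
  also have "\<dots> = (2 / \<epsilon> * (2 * 2 ^ n) * sqrt (real n) ^ (n + 1) * exp 1 * (1 - \<delta>) powr (1 / p) * l powr \<epsilon>) powr p"
  proof -
    have prod: "(a * b * c * d * e * f) powr p = a powr p * (b powr p * c powr p * (d powr p * e powr p)) * f powr p"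
      if "0 \<le> a" "0 \<le> b" "0 \<le> c" "0 \<le> d" "0 \<le> e" "0 \<le> f" for a b c d e f :: real
      using that by (simp add: powr_mult)
    have roots: "((1 - \<delta>) powr (1 / p)) powr p = 1 - \<delta>" "(l powr \<epsilon>) powr p = l powr (\<epsilon> * p)"
      using p \<delta> by (simp_all add: powr_powr)
    show ?thesis
      by (subst prod) (use \<epsilon> in \<open>simp_all only: roots, auto\<close>)
  qed
  also have "2 / \<epsilon> * (2 * 2 ^ n) * sqrt (real n) ^ (n + 1) * exp 1 * (1 - \<delta>) powr (1 / p) * l powr \<epsilon>
      = bbm_constant n * ((1 - \<delta>) powr (1 / p) / \<epsilon>) * l powr \<epsilon>"
    by (simp add: bbm_constant_def)
  finally show ?thesis .
qed

section \<open>Passing from Lebesgue measurable to Borel functions\<close>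

lemma locally_integrable_on_bounded:
  assumes "locally_integrable f" "bounded Q" "Q \<in> sets borel"
  shows "set_integrable lebesgue Q f"
proof (rule set_integrable_subset)
  show "set_integrable lebesgue (closure Q) f"
    using assms by (simp add: locally_integrable_def)
qed (use assms closure_subset in auto)

text \<open>
  Fubini is applied on Borel product spaces, so the functions are replaced by Borel versions. Only
  their values on \<open>Q\<close> enter the statements.
\<close>

lemma borel_version_on:
  fixes f :: "real ^ 'n \<Rightarrow> real"
  assumes f: "locally_integrable f" and Q: "bounded Q" "Q \<in> sets borel"
  obtains f' where "f' \<in> borel_measurable borel" "AE x in lborel. x \<in> Q \<longrightarrow> f x = f' x"
    "set_integrable lborel Q f'" "(LINT x:Q|lebesgue. f x) = (LINT x:Q|lborel. f' x)"
proof -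
  have int: "set_integrable lebesgue Q f"
    using assms by (rule locally_integrable_on_bounded)
  then have "(\<lambda>x. indicator Q x *\<^sub>R f x) \<in> borel_measurable lebesgue"
    unfolding set_integrable_def by auto
  from completion_ex_borel_measurable_real[OF this]
  obtain f' where [measurable]: "f' \<in> borel_measurable borel" and eq: "AE x in lborel. indicator Q x *\<^sub>R f x = f' x"
    by auto
  have ae: "AE x in lborel. x \<in> Q \<longrightarrow> f x = f' x"
    using eq by eventually_elim (auto simp: indicator_def)
  then have ae': "AE x in lebesgue. indicator Q x *\<^sub>R f x = indicator Q x *\<^sub>R f' x"
    by (intro AE_completion) (auto elim!: eventually_mono simp: indicator_def)
  note [measurable] = Q(2)
  have m: "(\<lambda>x. indicator Q x *\<^sub>R f' x) \<in> borel_measurable lborel"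
    by measurable
  have m': "(\<lambda>x. indicator Q x *\<^sub>R f' x) \<in> borel_measurable lebesgue"
    using m by (rule measurable_completion)
  have mf: "(\<lambda>x. indicator Q x *\<^sub>R f x) \<in> borel_measurable lebesgue"
    by fact
  show thesis
  proof
    show "set_integrable lborel Q f'"
      using int unfolding set_integrable_def
      by (simp only: integrable_cong_AE[OF mf m' ae'] integrable_completion[OF m])
    show "(LINT x:Q|lebesgue. f x) = (LINT x:Q|lborel. f' x)"
      unfolding set_lebesgue_integral_def
      by (simp only: integral_cong_AE[OF mf m' ae'] integral_completion[OF m])
  qed (use ae in auto)
qed

lemma frac_seminorm_borel:
  fixes u u' :: "real ^ 'n \<Rightarrow> real"
  assumes ae: "AE x in lborel. x \<in> Q \<longrightarrow> u x = u' x"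
  shows "frac_seminorm \<delta> p Q W u = epowr (\<integral>\<^sup>+x\<in>Q. (\<integral>\<^sup>+y\<in>Q. frac_kernel \<delta> p u' x y \<partial>lborel) * W x \<partial>lborel) (1 / p)"
proof -
  have inner: "(\<integral>\<^sup>+y\<in>Q. frac_kernel \<delta> p u x y \<partial>lborel) = (\<integral>\<^sup>+y\<in>Q. frac_kernel \<delta> p u' x y \<partial>lborel)"
    if "u x = u' x" for x
    using ae by (intro nn_integral_cong_AE) (auto elim!: eventually_mono simp: indicator_def frac_kernel_def that)
  have "(\<integral>\<^sup>+x\<in>Q. (\<integral>\<^sup>+y\<in>Q. frac_kernel \<delta> p u x y \<partial>lborel) * W x \<partial>lborel)
      = (\<integral>\<^sup>+x\<in>Q. (\<integral>\<^sup>+y\<in>Q. frac_kernel \<delta> p u' x y \<partial>lborel) * W x \<partial>lborel)"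
    using ae by (intro nn_integral_cong_AE) (auto elim!: eventually_mono simp: inner split: split_indicator)
  then show ?thesis
    by (simp add: frac_seminorm_def frac_kernel_def nn_integral_completion)
qed

lemma frac_seminorm_mono:
  assumes "0 < p" "\<And>x. x \<in> Q \<Longrightarrow> W x \<le> W' x"
  shows "frac_seminorm \<delta> p Q W u \<le> frac_seminorm \<delta> p Q W' u"
  unfolding frac_seminorm_def using assms
  by (intro epowr_mono nn_integral_mono) (auto simp: indicator_def intro!: mult_left_mono)

text \<open>
  Each cell is one of the cubes in the supremum defining the maximal function, so the scaled averages
  of the weight are bounded by it pointwise. Their integrals against the energy are then bounded by
  monotonicity, also for a maximal function of unknown measurability.
\<close>

lemma weighted_osc_le_local_maximal:
  fixes u w :: "real ^ 'n \<Rightarrow> real"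
  assumes p: "1 \<le> p" and w: "locally_integrable w" and Q: "cube_of_side Q l" and u: "locally_integrable u"
    and \<delta>: "0 < \<delta>" "\<delta> < 1" and \<epsilon>: "0 < \<epsilon>" "\<epsilon> \<le> 1"
  shows "weighted_osc p Q w u
    \<le> ennreal (bbm_constant CARD('n) * ((1 - \<delta>) powr (1 / p) / \<epsilon>) * l powr \<epsilon>)
      * frac_seminorm \<delta> p Q (local_frac_maximal ((\<delta> - \<epsilon>) * p) Q (\<lambda>x. w x * indicat_real Q x)) u"
proof -
  have l: "0 < l"
    and "\<exists>I a. (\<forall>i. {a i<..<a i + l} \<subseteq> I i \<and> I i \<subseteq> {a i..a i + l}) \<and> Q = {x. \<forall>i. x $ i \<in> I i}"
    using Q by (auto simp only: cube_of_side_def)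
  then obtain I a
    where "(\<forall>i. {a i<..<a i + l} \<subseteq> I i \<and> I i \<subseteq> {a i..a i + l}) \<and> Q = {x. \<forall>i. x $ i \<in> I i}"
    by (elim exE) (rule that)
  then interpret cube_grid Q I a l
    using l by unfold_locales auto
  let ?n = "real CARD('n)"
  define W where "W = local_frac_maximal ((\<delta> - \<epsilon>) * p) Q (\<lambda>x. w x * indicat_real Q x)"
  obtain u' where u' [measurable]: "u' \<in> borel_measurable borel" and u'_ae: "AE x in lborel. x \<in> Q \<longrightarrow> u x = u' x"
    and u'_int: "set_integrable lborel Q u'" and u'_avg: "(LINT x:Q|lebesgue. u x) = (LINT x:Q|lborel. u' x)"
    using borel_version_on[OF u cube_bounded[OF Q] Q_borel] .
  obtain w' where w' [measurable]: "w' \<in> borel_measurable borel" and w'_ae: "AE x in lborel. x \<in> Q \<longrightarrow> w x = w' x"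
    using borel_version_on[OF w cube_bounded[OF Q] Q_borel] .
  have avg: "average Q u = (LINT x:Q|lborel. u' x) / l powr ?n"
    using cube_emeasure[OF Q] by (simp add: average_def u'_avg measure_def)
  define T where "T = (\<integral>\<^sup>+x\<in>Q. energy \<delta> p u' x * W x \<partial>lborel)"
  have "(\<integral>\<^sup>+x\<in>Q. ennreal (\<bar>u x - average Q u\<bar> powr p * w x) \<partial>lebesgue)
      = (\<integral>\<^sup>+x\<in>Q. ennreal (\<bar>u' x - (LINT x:Q|lborel. u' x) / l powr ?n\<bar> powr p) * ennreal (w' x) \<partial>lborel)"
    unfolding nn_integral_completion avg using u'_ae w'_ae
    by (intro nn_integral_cong_AE, eventually_elim) (auto simp: indicator_def ennreal_mult')
  also have "\<dots> \<le> ennreal ((1 / (1 - 2 powr - \<epsilon>)) powr p * (2 * 2 ^ CARD('n) * sqrt ?n powr (?n + \<delta> * p) * (p * (1 - \<delta>)))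
        * l powr (\<epsilon> * p)) * T"
  proof (rule weighted_oscillation_le[OF u' _ u'_int p \<delta> \<epsilon>(1)])
    fix k
    have "ennreal (side k powr ((\<delta> - \<epsilon>) * p - ?n)) * (\<integral>\<^sup>+x\<in>cell k y. ennreal (w' x) \<partial>lborel) \<le> W y" if y: "y \<in> Q" for y
    proof -
      have "(\<integral>\<^sup>+x\<in>cell k y. ennreal (w' x) \<partial>lborel) \<le> (\<integral>\<^sup>+x\<in>cell k y. ennreal \<bar>w x * indicat_real Q x\<bar> \<partial>lebesgue)"
        unfolding nn_integral_completion using w'_ae
        by (intro nn_integral_mono_AE, eventually_elim)
           (use cell_subset[of k y] in \<open>auto simp: indicator_def intro!: ennreal_leI\<close>)
      then have "ennreal (side k powr ((\<delta> - \<epsilon>) * p - ?n)) * (\<integral>\<^sup>+x\<in>cell k y. ennreal (w' x) \<partial>lborel)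
          \<le> ennreal (side k powr ((\<delta> - \<epsilon>) * p - ?n)) * (\<integral>\<^sup>+x\<in>cell k y. ennreal \<bar>w x * indicat_real Q x\<bar> \<partial>lebesgue)"
        by (rule mult_left_mono) simp
      also have "\<dots> = ennreal (side_length (cell k y) powr ((\<delta> - \<epsilon>) * p)) * abs_average (cell k y) (\<lambda>x. w x * indicat_real Q x)"
      proof -
        have "emeasure lebesgue (cell k y) = ennreal (side k powr ?n)"
          using cube_emeasure[OF cell_side[OF y]] cell_borel[OF y] by simp
        moreover have "ennreal (side k powr ((\<delta> - \<epsilon>) * p - ?n)) = ennreal (side k powr ((\<delta> - \<epsilon>) * p)) / ennreal (side k powr ?n)"
          using side_pos[of k] by (simp add: powr_diff divide_ennreal)
        ultimately show ?thesis
          by (simp add: side_length_eq[OF cell_side[OF y]] abs_average_def ennreal_divide_times)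
      qed
      also have "\<dots> \<le> W y"
        unfolding W_def local_frac_maximal_def
        using cell_side[OF y] cell_subset self_in_cell[OF y]
        by (intro SUP_upper) (auto simp: is_cube_def)
      finally show ?thesis .
    qed
    then show "(\<integral>\<^sup>+y\<in>Q. energy \<delta> p u' y * (ennreal (side k powr ((\<delta> - \<epsilon>) * p - ?n))
        * (\<integral>\<^sup>+x\<in>cell k y. ennreal (w' x) \<partial>lborel)) \<partial>lborel) \<le> T"
      unfolding T_def by (intro nn_integral_mono) (auto simp: indicator_def intro!: mult_left_mono)
  qed measurable
  also have "\<dots> \<le> ennreal ((bbm_constant CARD('n) * ((1 - \<delta>) powr (1 / p) / \<epsilon>) * l powr \<epsilon>) powr p) * T"
    using p \<delta> \<epsilon> l by (intro mult_right_mono ennreal_leI bbm_constant_bound) auto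
  finally have "weighted_osc p Q w u
      \<le> epowr (ennreal ((bbm_constant CARD('n) * ((1 - \<delta>) powr (1 / p) / \<epsilon>) * l powr \<epsilon>) powr p) * T) (1 / p)"
    unfolding weighted_osc_def using p by (intro epowr_mono) auto
  also have "\<dots> = ennreal (bbm_constant CARD('n) * ((1 - \<delta>) powr (1 / p) / \<epsilon>) * l powr \<epsilon>) * epowr T (1 / p)"
    using p \<epsilon> by (simp add: epowr_mult epowr_ennreal powr_powr bbm_constant_def)
  also have "epowr T (1 / p) = frac_seminorm \<delta> p Q W u"
    unfolding T_def energy_def by (rule frac_seminorm_borel[OF u'_ae, symmetric])
  finally show ?thesis
    unfolding W_def .
qed

section \<open>Comparison of maximal functions\<close>

lemma local_frac_maximal_0_le: "local_frac_maximal 0 Q f x \<le> HL_maximal f x"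
  unfolding local_frac_maximal_def HL_maximal_def
proof (rule SUP_mono)
  fix R assume R: "R \<in> {R. is_cube R \<and> R \<subseteq> Q \<and> x \<in> R}"
  then obtain r where "cube_of_side R r"
    by (auto simp: is_cube_def)
  then have "0 < side_length R"
    using side_length_eq cube_side_pos by metis
  then show "\<exists>R'\<in>{R. is_cube R \<and> x \<in> R}. ennreal (side_length R powr 0) * abs_average R f \<le> abs_average R' f"
    using R by (intro bexI[of _ R]) auto
qed

lemma HL_maximal_restrict_le: "HL_maximal (\<lambda>x. w x * indicat_real Q x) x \<le> HL_maximal w x"
  unfolding HL_maximal_def
proof (rule SUP_mono)
  fix R assume R: "R \<in> {R. is_cube R \<and> x \<in> R}"
  have "abs_average R (\<lambda>x. w x * indicat_real Q x) \<le> abs_average R w"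
    unfolding abs_average_def
    by (intro divide_right_mono_ennreal nn_integral_mono) (auto simp: indicator_def)
  with R show "\<exists>R'\<in>{R. is_cube R \<and> x \<in> R}. abs_average R (\<lambda>x. w x * indicat_real Q x) \<le> abs_average R' w"
    by blast
qed

lemma A1_pair_maximal_le:
  assumes "A1_pair w v"
  shows "AE x in lborel. HL_maximal w x \<le> A1_const w v * ennreal (v x)"
proof -
  have "AE x in lebesgue. HL_maximal w x / ennreal (v x) \<le> A1_const w v"
    unfolding A1_const_def by (rule esssup_AE)
  moreover have "AE x in lebesgue. v x > 0"
    using assms by (simp add: A1_pair_def weight_def)
  ultimately have "AE x in lebesgue. HL_maximal w x \<le> A1_const w v * ennreal (v x)"
  proof eventually_elim
    case (elim x)
    have "HL_maximal w x = HL_maximal w x / ennreal (v x) * ennreal (v x)"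
      using elim(2) by (simp add: ennreal_divide_times ennreal_divide_self)
    also have "\<dots> \<le> A1_const w v * ennreal (v x)"
      using elim(1) by (rule mult_right_mono) simp
    finally show ?case .
  qed
  then show ?thesis
    by (simp add: AE_completion_iff)
qed

text \<open>
  The constant is pulled out of the integral after \<open>v\<close> and \<open>u\<close> are replaced by Borel versions, for
  which the integrand is measurable.
\<close>

lemma frac_seminorm_A1_le:
  fixes u v w :: "real ^ 'n \<Rightarrow> real"
  assumes A1: "A1_pair w v" and p: "0 < p" and Q: "cube_of_side Q l" and u: "locally_integrable u"
  shows "frac_seminorm \<delta> p Q (HL_maximal w) u
    \<le> epowr (A1_const w v) (1 / p) * frac_seminorm \<delta> p Q (\<lambda>x. ennreal (v x)) u"
proof -
  let ?A = "A1_const w v"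
  note [measurable] = cube_borel[OF Q]
  obtain u' where [measurable]: "u' \<in> borel_measurable borel" and u'_ae: "AE x in lborel. x \<in> Q \<longrightarrow> u x = u' x"
    using borel_version_on[OF u cube_bounded[OF Q] cube_borel[OF Q]] .
  have "locally_integrable v"
    using A1 by (simp add: A1_pair_def weight_def)
  then obtain v' where [measurable]: "v' \<in> borel_measurable borel" and v'_ae: "AE x in lborel. x \<in> Q \<longrightarrow> v x = v' x"
    using borel_version_on[OF _ cube_bounded[OF Q] cube_borel[OF Q]] by blast
  define g where "g x = (\<integral>\<^sup>+y\<in>Q. frac_kernel \<delta> p u' x y \<partial>lborel)" for x
  have [measurable]: "g \<in> borel_measurable borel"
    unfolding g_def by measurable
  have "(\<integral>\<^sup>+x\<in>Q. g x * HL_maximal w x \<partial>lborel) \<le> (\<integral>\<^sup>+x. ?A * (g x * ennreal (v' x) * indicator Q x) \<partial>lborel)"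
    using A1_pair_maximal_le[OF A1] v'_ae
  proof (intro nn_integral_mono_AE, eventually_elim)
    case (elim x)
    then have "g x * HL_maximal w x \<le> g x * (?A * ennreal (v x))"
      by (intro mult_left_mono) auto
    with elim show ?case
      by (auto simp: indicator_def mult_ac)
  qed
  also have "\<dots> = ?A * (\<integral>\<^sup>+x\<in>Q. g x * ennreal (v' x) \<partial>lborel)"
    by (rule nn_integral_cmult) measurable
  also have "(\<integral>\<^sup>+x\<in>Q. g x * ennreal (v' x) \<partial>lborel) = (\<integral>\<^sup>+x\<in>Q. g x * ennreal (v x) \<partial>lborel)"
    using v'_ae by (intro nn_integral_cong_AE) (auto elim!: eventually_mono simp: indicator_def)
  finally show ?thesis
    using p unfolding frac_seminorm_borel[OF u'_ae] g_def[symmetric]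
    by (simp add: epowr_mult[symmetric] epowr_mono)
qed

theorem theorem2p9:
  shows "\<exists>c::real. c > 0 \<and>
    (\<forall>(p::real) (w :: real ^ 'n \<Rightarrow> real) (Q :: (real ^ 'n) set) (u :: real ^ 'n \<Rightarrow> real).
      1 \<le> p \<longrightarrow> weight w \<longrightarrow> is_cube Q \<longrightarrow> locally_integrable u \<longrightarrow>
      (\<forall>(\<delta>::real) (\<epsilon>::real). 0 < \<delta> \<longrightarrow> \<delta> < 1 \<longrightarrow> 0 < \<epsilon> \<longrightarrow> \<epsilon> \<le> \<delta> \<longrightarrow>
         weighted_osc p Q w u
         \<le> ennreal (c * ((1 - \<delta>) powr (1 / p) / \<epsilon>) * side_length Q powr \<epsilon>)
           * frac_seminorm \<delta> p Q
               (local_frac_maximal ((\<delta> - \<epsilon>) * p) Q (\<lambda>x. w x * indicat_real Q x)) u) \<and>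
      (\<forall>\<delta>::real. 1 / 2 < \<delta> \<longrightarrow> \<delta> < 1 \<longrightarrow>
         weighted_osc p Q w u
         \<le> ennreal (c * (1 - \<delta>) powr (1 / p) * side_length Q powr \<delta>)
           * frac_seminorm \<delta> p Q (HL_maximal (\<lambda>x. w x * indicat_real Q x)) u \<and>
         (\<forall>v :: real ^ 'n \<Rightarrow> real. A1_pair w v \<longrightarrow>
           weighted_osc p Q w u
           \<le> ennreal (c * (1 - \<delta>) powr (1 / p) * side_length Q powr \<delta>)
             * epowr (A1_const w v) (1 / p)
             * frac_seminorm \<delta> p Q (\<lambda>x. ennreal (v x)) u)))"
proof -
  define c where "c = 2 * bbm_constant CARD('n)"
  have c0: "0 < bbm_constant CARD('n)"
    by (simp add: bbm_constant_def)
  then have "0 < c"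
    by (simp add: c_def)
  moreover have A: "weighted_osc p Q w u
      \<le> ennreal (c * ((1 - \<delta>) powr (1 / p) / \<epsilon>) * side_length Q powr \<epsilon>)
        * frac_seminorm \<delta> p Q (local_frac_maximal ((\<delta> - \<epsilon>) * p) Q (\<lambda>x. w x * indicat_real Q x)) u"
    if h: "1 \<le> p" "weight w" "is_cube Q" "locally_integrable u" "0 < \<delta>" "\<delta> < 1" "0 < \<epsilon>" "\<epsilon> \<le> \<delta>"
    for p \<delta> \<epsilon> Q and w u :: "real ^ 'n \<Rightarrow> real"
  proof -
    obtain l where l: "cube_of_side Q l"
      using h(3) by (auto simp: is_cube_def)
    have "weighted_osc p Q w u
        \<le> ennreal (bbm_constant CARD('n) * ((1 - \<delta>) powr (1 / p) / \<epsilon>) * l powr \<epsilon>)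
          * frac_seminorm \<delta> p Q (local_frac_maximal ((\<delta> - \<epsilon>) * p) Q (\<lambda>x. w x * indicat_real Q x)) u"
      using h by (intro weighted_osc_le_local_maximal[OF _ _ l]) (auto simp: weight_def)
    also have "\<dots> \<le> ennreal (c * ((1 - \<delta>) powr (1 / p) / \<epsilon>) * l powr \<epsilon>)
          * frac_seminorm \<delta> p Q (local_frac_maximal ((\<delta> - \<epsilon>) * p) Q (\<lambda>x. w x * indicat_real Q x)) u"
      using h c0 by (intro mult_right_mono ennreal_leI) (auto simp: c_def)
    finally show ?thesis
      by (simp add: side_length_eq[OF l])
  qed
  moreover have B: "weighted_osc p Q w u
      \<le> ennreal (c * (1 - \<delta>) powr (1 / p) * side_length Q powr \<delta>)
        * frac_seminorm \<delta> p Q (HL_maximal (\<lambda>x. w x * indicat_real Q x)) u"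
    if h: "1 \<le> p" "weight w" "is_cube Q" "locally_integrable u" "1 / 2 < \<delta>" "\<delta> < 1"
    for p \<delta> Q and w u :: "real ^ 'n \<Rightarrow> real"
  proof -
    obtain l where l: "cube_of_side Q l"
      using h(3) by (auto simp: is_cube_def)
    have "weighted_osc p Q w u
        \<le> ennreal (bbm_constant CARD('n) * ((1 - \<delta>) powr (1 / p) / \<delta>) * l powr \<delta>)
          * frac_seminorm \<delta> p Q (local_frac_maximal ((\<delta> - \<delta>) * p) Q (\<lambda>x. w x * indicat_real Q x)) u"
      using h by (intro weighted_osc_le_local_maximal[OF _ _ l]) (auto simp: weight_def)
    also have "\<dots> \<le> ennreal (c * (1 - \<delta>) powr (1 / p) * l powr \<delta>)
          * frac_seminorm \<delta> p Q (HL_maximal (\<lambda>x. w x * indicat_real Q x)) u"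
    proof (rule mult_mono)
      have "(1 - \<delta>) powr (1 / p) / \<delta> \<le> (1 - \<delta>) powr (1 / p) / (1 / 2)"
        using h by (intro divide_left_mono) auto
      then have "bbm_constant CARD('n) * ((1 - \<delta>) powr (1 / p) / \<delta>) \<le> c * (1 - \<delta>) powr (1 / p)"
        using mult_left_mono[of _ _ "bbm_constant CARD('n)"] c0 by (fastforce simp: c_def)
      then show "ennreal (bbm_constant CARD('n) * ((1 - \<delta>) powr (1 / p) / \<delta>) * l powr \<delta>)
          \<le> ennreal (c * (1 - \<delta>) powr (1 / p) * l powr \<delta>)"
        by (intro ennreal_leI mult_right_mono) auto
      show "frac_seminorm \<delta> p Q (local_frac_maximal ((\<delta> - \<delta>) * p) Q (\<lambda>x. w x * indicat_real Q x)) u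
          \<le> frac_seminorm \<delta> p Q (HL_maximal (\<lambda>x. w x * indicat_real Q x)) u"
        using h by (intro frac_seminorm_mono) (auto simp: local_frac_maximal_0_le)
    qed auto
    finally show ?thesis
      by (simp add: side_length_eq[OF l])
  qed
  moreover have "weighted_osc p Q w u
      \<le> ennreal (c * (1 - \<delta>) powr (1 / p) * side_length Q powr \<delta>) * epowr (A1_const w v) (1 / p)
        * frac_seminorm \<delta> p Q (\<lambda>x. ennreal (v x)) u"
    if h: "1 \<le> p" "weight w" "is_cube Q" "locally_integrable u" "1 / 2 < \<delta>" "\<delta> < 1" and A1: "A1_pair w v"
    for p \<delta> Q and w u v :: "real ^ 'n \<Rightarrow> real"
  proof -
    obtain l where l: "cube_of_side Q l"
      using h(3) by (auto simp: is_cube_def)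
    have "frac_seminorm \<delta> p Q (HL_maximal (\<lambda>x. w x * indicat_real Q x)) u \<le> frac_seminorm \<delta> p Q (HL_maximal w) u"
      using h by (intro frac_seminorm_mono HL_maximal_restrict_le) auto
    also have "\<dots> \<le> epowr (A1_const w v) (1 / p) * frac_seminorm \<delta> p Q (\<lambda>x. ennreal (v x)) u"
      using h by (intro frac_seminorm_A1_le[OF A1 _ l]) auto
    finally have "ennreal (c * (1 - \<delta>) powr (1 / p) * side_length Q powr \<delta>)
          * frac_seminorm \<delta> p Q (HL_maximal (\<lambda>x. w x * indicat_real Q x)) u
        \<le> ennreal (c * (1 - \<delta>) powr (1 / p) * side_length Q powr \<delta>)
          * (epowr (A1_const w v) (1 / p) * frac_seminorm \<delta> p Q (\<lambda>x. ennreal (v x)) u)"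
      by (rule mult_left_mono) simp
    with B[OF h] show ?thesis
      by (simp add: mult.assoc)
  qed
  ultimately show ?thesis
    by blast
qed

end
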